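(* Let $\lambda>0$, $p,q\in[1,\infty]$, and let $\mathcal{U}_{F_q}=\{\boldsymbol\Delta\in\mathbb{R}^{m\times n}:\|\boldsymbol\Delta\|_{F_q}\le\lambda\}$. (a) For any $\mathbf{z}\in\mathbb{R}^m$ and $\boldsymbol\beta\in\mathbb{R}^n$, $$\max_{\boldsymbol\Delta\in\mathcal{U}_{F_q}} \|\mathbf{z}+\boldsymbol\Delta\boldsymbol\beta\|_p \leq \|\mathbf{z}\|_p + \lambda\,\delta_m(p,q)\|\boldsymbol\beta\|_{q^*}.\qquad(\mathrm{UB})$$ (b) When $p\in\{1,\infty\}$, there is equality in (UB) for all $(\mathbf{z},\boldsymbol\beta)\in\mathbb{R}^m\times\mathbb{R}^n$. (c) When $p\in(1,\infty)$, $p\neq q$ and $m\ge2$, for any $\boldsymbol\beta\neq\mathbf{0}$ the set of $\mathbf{z}\in\mathbb{R}^m$ for which (UB) holds with equality is a finite union of one-dimensional subspaces. Hence, for any $\boldsymbol\beta\neq\mathbf{0}$ the inequality (UB) is strict for almost all $\mathbf{z}$. (d) For $p\in(1,\infty)$, one has for all $\mathbf{z}\in\mathbb{R}^m$ and $\boldsymbol\beta\in\mathbb{R}^n$ that $$\|\mathbf{z}\|_p + \frac{\lambda}{\delta_m(q,p)}\|\boldsymbol\beta\|_{q^*}\leq\max_{\boldsymbol\Delta\in\mathcal{U}_{F_q}} \|\mathbf{z}+\boldsymbol\Delta\boldsymbol\beta\|_p.$$ (e) For $p\in(1,\infty)$, the lower bound in (d) is best possible in the sense that the gap can be arbitrarily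 small, i.e., for any $\boldsymbol\beta\in\mathbb{R}^n$, $$\inf_{\mathbf{z}\in\mathbb{R}^m}\left(\max_{\boldsymbol\Delta\in\mathcal{U}_{F_q}} \|\mathbf{z}+\boldsymbol\Delta\boldsymbol\beta\|_p-\|\mathbf{z}\|_p - \frac{\lambda}{\delta_m(q,p)}\|\boldsymbol\beta\|_{q^*}\right)=0.$$
   Context: $\|\cdot\|_p$ is the $\ell_p$ norm on $\mathbb{R}^k$. For $q\in[1,\infty]$, $q^*\in[1,\infty]$ is the conjugate exponent, $1/q+1/q^*=1$ (with $1/\infty=0$). For $\boldsymbol\Delta\in\mathbb{R}^{m\times n}$, $\|\boldsymbol\Delta\|_{F_q}$ is the entrywise $\ell_q$ norm: $(\sum_{ij}|\Delta_{ij}|^q)^{1/q}$ if $q<\infty$, and $\max_{ij}|\Delta_{ij}|$ if $q=\infty$. For $a,b\in[1,\infty]$, the discrepancy function is $\delta_m(a,b):=\max\{\|\mathbf{u}\|_a:\mathbf{u}\in\mathbb{R}^m,\ \|\mathbf{u}\|_b=1\}$. "Almost all" is with respect to Lebesgue measure on $\mathbb{R}^m$. *)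

theory Defs
  imports "HOL-Analysis.Analysis"
begin

text \<open>Exponents range over \<open>[1,\<infinity>]\<close> and are taken in \<^typ>\<open>ennreal\<close>, with \<open>1 / \<infinity> = 0\<close>.
  Families indexed by a finite type cover both vectors and (entrywise) matrices.\<close>

definition lp_fam :: "ennreal \<Rightarrow> ('i::finite \<Rightarrow> real) \<Rightarrow> real" where
  "lp_fam p f = (if p = \<infinity> then Max (range (\<lambda>i. \<bar>f i\<bar>))
     else (\<Sum>i\<in>UNIV. \<bar>f i\<bar> powr enn2real p) powr (1 / enn2real p))"

definition lp_norm :: "ennreal \<Rightarrow> real ^ 'k \<Rightarrow> real" where
  "lp_norm p x = lp_fam p (\<lambda>i. x $ i)"

definition F_norm :: "ennreal \<Rightarrow> real ^ 'n ^ 'm \<Rightarrow> real" where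
  "F_norm q \<Delta> = lp_fam q (\<lambda>(i, j). \<Delta> $ i $ j)"

text \<open>The solution of \<open>1 / q + 1 / conj_exponent q = 1\<close>, including the endpoints \<open>1\<close> and \<open>\<infinity>\<close>;
  see \<open>conj_exponent\<close> and \<open>conj_exponent_unique\<close>.\<close>

definition conj_exponent :: "ennreal \<Rightarrow> ennreal" where
  "conj_exponent q = inverse (1 - inverse q)"

text \<open>The maxima below are written as suprema; they are shown to be attained in
  \<open>discrepancy_attained\<close> and \<open>worst_case_attained\<close>.\<close>

definition discrepancy :: "'m::finite itself \<Rightarrow> ennreal \<Rightarrow> ennreal \<Rightarrow> real" where
  "discrepancy _ a b = (SUP u\<in>{u :: real ^ 'm. lp_norm b u = 1}. lp_norm a u)"

definition uncertainty_set :: "real \<Rightarrow> ennreal \<Rightarrow> (real ^ 'n ^ 'm) set" where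
  "uncertainty_set \<rho> q = {\<Delta>. F_norm q \<Delta> \<le> \<rho>}"

definition worst_case ::
    "real \<Rightarrow> ennreal \<Rightarrow> ennreal \<Rightarrow> real ^ 'm \<Rightarrow> real ^ 'n \<Rightarrow> real" where
  "worst_case \<rho> p q z \<beta> =
     (SUP \<Delta>\<in>(uncertainty_set \<rho> q :: (real ^ 'n ^ 'm) set). lp_norm p (z + \<Delta> *v \<beta>))"

lemma ennreal_inverse_inverse: "inverse (inverse x) = x" for x :: ennreal
proof (cases x)
  case (real r)
  then show ?thesis by (cases "r = 0") (auto simp: inverse_ennreal)
qed simp

lemma ennreal_inverse_le_1: "inverse x \<le> 1" if "1 \<le> x" for x :: ennreal
proof (cases x)
  case (real r)
  with that have "1 \<le> r" by simp
  with real show ?thesis by (simp add: inverse_ennreal inverse_le_1_iff)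
qed simp

lemma ennreal_inverse_ge_1: "1 \<le> inverse x" if "x \<le> 1" for x :: ennreal
proof (cases x)
  case (real r)
  with that have "r \<le> 1" by simp
  with real show ?thesis by (cases "r = 0") (auto simp: inverse_ennreal one_le_inverse)
qed (use that in \<open>auto simp: top_unique\<close>)

lemma conj_exponent:
  assumes "1 \<le> q"
  shows "1 \<le> conj_exponent q" "1 / q + 1 / conj_exponent q = 1"
proof -
  show "1 \<le> conj_exponent q"
    unfolding conj_exponent_def by (intro ennreal_inverse_ge_1 diff_le_self_ennreal)
  show "1 / q + 1 / conj_exponent q = 1"
    using ennreal_inverse_le_1[OF assms]
    by (simp add: conj_exponent_def divide_ennreal_def ennreal_inverse_inverse add_diff_inverse_ennreal)
qed

lemma conj_exponent_unique:
  assumes "1 \<le> q" "1 / q + 1 / r = 1"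
  shows "r = conj_exponent q"
proof -
  have e: "inverse q + inverse r = 1" using assms(2) by (simp add: divide_ennreal_def)
  have "inverse q \<noteq> \<infinity>" using ennreal_inverse_le_1[OF assms(1)] by (auto simp: top_unique)
  then have "inverse q + inverse r - inverse q = inverse r"
    by (simp add: ennreal_add_diff_cancel_left)
  then show ?thesis unfolding conj_exponent_def e by (metis ennreal_inverse_inverse)
qed

lemma enn2real_ge_1: "1 \<le> p \<Longrightarrow> p \<noteq> \<infinity> \<Longrightarrow> 1 \<le> enn2real p"
  by (cases p) auto

lemma lp_fam_zero: "lp_fam p (\<lambda>i. 0) = 0"
  by (simp add: lp_fam_def)

lemma abs_le_lp_fam:
  fixes f :: "'i::finite \<Rightarrow> real"
  assumes "1 \<le> p"
  shows "\<bar>f i\<bar> \<le> lp_fam p f"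
proof (cases "p = \<infinity>")
  case True
  then show ?thesis by (auto simp: lp_fam_def intro: Max_ge)
next
  case False
  let ?r = "enn2real p"
  have r: "1 \<le> ?r" using assms False by (rule enn2real_ge_1)
  have "\<bar>f i\<bar> powr ?r \<le> (\<Sum>i\<in>UNIV. \<bar>f i\<bar> powr ?r)"
    by (rule member_le_sum) auto
  then have "(\<bar>f i\<bar> powr ?r) powr (1 / ?r) \<le> (\<Sum>i\<in>UNIV. \<bar>f i\<bar> powr ?r) powr (1 / ?r)"
    using r by (intro powr_mono2) auto
  moreover have "(\<bar>f i\<bar> powr ?r) powr (1 / ?r) = \<bar>f i\<bar>" using r by (simp add: powr_powr)
  ultimately show ?thesis using False by (simp add: lp_fam_def)
qed

lemma continuous_on_Max_fam:
  fixes g :: "'i \<Rightarrow> 'a::topological_space \<Rightarrow> real"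
  assumes "finite I" "I \<noteq> {}" "\<And>i. i \<in> I \<Longrightarrow> continuous_on S (g i)"
  shows "continuous_on S (\<lambda>x. Max ((\<lambda>i. g i x) ` I))"
  using assms
proof (induction I rule: finite_ne_induct)
  case (insert i I)
  then have "continuous_on S (\<lambda>x. max (g i x) (Max ((\<lambda>i. g i x) ` I)))"
    by (intro continuous_on_max) auto
  with insert show ?case by simp
qed auto

lemma continuous_on_lp_fam:
  fixes g :: "'i::finite \<Rightarrow> 'a::topological_space \<Rightarrow> real"
  assumes "1 \<le> p" "\<And>i. continuous_on S (g i)"
  shows "continuous_on S (\<lambda>x. lp_fam p (\<lambda>i. g i x))"
proof (cases "p = \<infinity>")
  case True
  have "continuous_on S (\<lambda>x. Max (range (\<lambda>i. \<bar>g i x\<bar>)))"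
    by (rule continuous_on_Max_fam) (auto intro!: continuous_intros assms)
  with True show ?thesis by (simp add: lp_fam_def)
next
  case False
  have r: "1 \<le> enn2real p" using assms(1) False by (rule enn2real_ge_1)
  have "continuous_on S
      (\<lambda>x. (\<Sum>i\<in>UNIV. \<bar>g i x\<bar> powr enn2real p) powr (1 / enn2real p))"
    using r by (intro continuous_on_powr' continuous_intros assms) (auto intro: sum_nonneg)
  with False show ?thesis by (simp add: lp_fam_def)
qed

lemma continuous_on_lp_norm:
  assumes "1 \<le> p" "continuous_on S h"
  shows "continuous_on S (\<lambda>x. lp_norm p (h x))"
  unfolding lp_norm_def by (intro continuous_on_lp_fam continuous_intros assms)

lemma lp_norm_axis:
  assumes "1 \<le> p"
  shows "lp_norm p (axis i 1 :: real ^ 'm) = 1"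
proof (cases "p = \<infinity>")
  case True
  have "Max (range (\<lambda>j. \<bar>(axis i 1 :: real ^ 'm) $ j\<bar>)) = 1"
    by (rule Max_eqI) (auto simp: axis_def image_iff intro: exI[of _ i])
  with True show ?thesis by (simp add: lp_norm_def lp_fam_def)
next
  case False
  have "(\<Sum>j\<in>UNIV. \<bar>(axis i 1 :: real ^ 'm) $ j\<bar> powr enn2real p)
      = (\<Sum>j\<in>UNIV. if j = i then 1 else 0)"
    by (rule sum.cong) (auto simp: axis_def)
  with False show ?thesis by (simp add: lp_norm_def lp_fam_def)
qed

lemma bounded_coords:
  fixes S :: "(real ^ 'm) set"
  assumes "\<And>x i. x \<in> S \<Longrightarrow> \<bar>x $ i\<bar> \<le> B"
  shows "bounded S"
proof (rule boundedI)
  fix x assume "x \<in> S"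
  have "norm x \<le> (\<Sum>i\<in>UNIV. \<bar>x $ i\<bar>)" by (rule norm_le_l1_cart)
  also have "\<dots> \<le> (\<Sum>i\<in>(UNIV :: 'm set). B)"
    by (rule sum_mono) (use assms \<open>x \<in> S\<close> in auto)
  finally show "norm x \<le> (\<Sum>i\<in>(UNIV :: 'm set). B)" .
qed

lemma compact_lp_sphere:
  assumes "1 \<le> b"
  shows "compact {u :: real ^ 'm. lp_norm b u = 1}"
proof -
  have "closed {u :: real ^ 'm. lp_norm b u = 1}"
    by (intro closed_Collect_eq continuous_on_lp_norm assms continuous_intros)
  moreover have "bounded {u :: real ^ 'm. lp_norm b u = 1}"
  proof (rule bounded_coords)
    fix u :: "real ^ 'm" and i assume "u \<in> {u. lp_norm b u = 1}"
    then show "\<bar>u $ i\<bar> \<le> 1"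
      using abs_le_lp_fam[OF assms, of "\<lambda>i. u $ i" i] by (simp add: lp_norm_def)
  qed
  ultimately show ?thesis by (simp add: compact_eq_bounded_closed)
qed

lemma compact_uncertainty_set:
  assumes "1 \<le> q"
  shows "compact (uncertainty_set \<rho> q :: (real ^ 'n ^ 'm) set)"
proof -
  have c: "continuous_on UNIV (\<lambda>\<Delta> :: real ^ 'n ^ 'm. F_norm q \<Delta>)"
    unfolding F_norm_def case_prod_beta
    by (intro continuous_on_lp_fam continuous_intros assms)
  then have "closed (uncertainty_set \<rho> q :: (real ^ 'n ^ 'm) set)"
    unfolding uncertainty_set_def by (intro closed_Collect_le continuous_intros)
  moreover have "bounded (uncertainty_set \<rho> q :: (real ^ 'n ^ 'm) set)"
  proof (rule boundedI)
    fix \<Delta> :: "real ^ 'n ^ 'm" assume a: "\<Delta> \<in> uncertainty_set \<rho> q"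
    have e: "\<bar>\<Delta> $ i $ j\<bar> \<le> \<rho>" for i j
      using abs_le_lp_fam[OF assms, of "\<lambda>(i, j). \<Delta> $ i $ j" "(i, j)"] a
      by (simp add: uncertainty_set_def F_norm_def)
    have "norm \<Delta> \<le> (\<Sum>i\<in>UNIV. norm (\<Delta> $ i))"
      unfolding norm_vec_def by (rule L2_set_le_sum) simp
    also have "\<dots> \<le> (\<Sum>i\<in>(UNIV :: 'm set). \<Sum>j\<in>(UNIV :: 'n set). \<rho>)"
      by (intro sum_mono order_trans[OF norm_le_l1_cart] e)
    finally show "norm \<Delta> \<le> (\<Sum>i\<in>(UNIV :: 'm set). \<Sum>j\<in>(UNIV :: 'n set). \<rho>)" .
  qed
  ultimately show ?thesis by (simp add: compact_eq_bounded_closed)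
qed

lemma SUP_attained:
  fixes f :: "'a::topological_space \<Rightarrow> real"
  assumes "compact S" "S \<noteq> {}" "continuous_on S f"
  shows "\<exists>x\<in>S. f x = (SUP y\<in>S. f y) \<and> (\<forall>y\<in>S. f y \<le> f x)"
proof -
  obtain x where x: "x \<in> S" "\<forall>y\<in>S. f y \<le> f x"
    using continuous_attains_sup[OF assms] by blast
  then have "(SUP y\<in>S. f y) = f x" by (intro cSup_eq_maximum) auto
  with x show ?thesis by auto
qed

lemma discrepancy_attained:
  assumes "1 \<le> a" "1 \<le> b"
  shows "\<exists>u :: real ^ 'm. lp_norm b u = 1 \<and> lp_norm a u = discrepancy TYPE('m) a b
    \<and> (\<forall>v :: real ^ 'm. lp_norm b v = 1 \<longrightarrow> lp_norm a v \<le> lp_norm a u)"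
proof -
  have "{u :: real ^ 'm. lp_norm b u = 1} \<noteq> {}"
    using lp_norm_axis[OF assms(2)] by blast
  from SUP_attained[OF compact_lp_sphere[OF assms(2)] this
      continuous_on_lp_norm[OF assms(1) continuous_on_id]]
  show ?thesis by (auto simp: discrepancy_def)
qed

lemma worst_case_attained:
  fixes z :: "real ^ 'm" and \<beta> :: "real ^ 'n"
  assumes "0 \<le> \<rho>" "1 \<le> p" "1 \<le> q"
  shows "\<exists>\<Delta>\<in>uncertainty_set \<rho> q. lp_norm p (z + \<Delta> *v \<beta>) = worst_case \<rho> p q z \<beta>
    \<and> (\<forall>\<Delta>'\<in>uncertainty_set \<rho> q. lp_norm p (z + \<Delta>' *v \<beta>) \<le> lp_norm p (z + \<Delta> *v \<beta>))"
proof -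
  have "(0 :: real ^ 'n ^ 'm) \<in> uncertainty_set \<rho> q"
    using assms(1)
    by (simp add: uncertainty_set_def F_norm_def case_prod_unfold lp_fam_zero)
  then have ne: "(uncertainty_set \<rho> q :: (real ^ 'n ^ 'm) set) \<noteq> {}" by blast
  have "continuous_on (uncertainty_set \<rho> q) (\<lambda>\<Delta> :: real ^ 'n ^ 'm. lp_norm p (z + \<Delta> *v \<beta>))"
    unfolding matrix_vector_mult_def
    by (intro continuous_on_lp_norm assms continuous_intros continuous_on_vec_lambda)
  from SUP_attained[OF compact_uncertainty_set[OF assms(3)] ne this]
  show ?thesis by (simp add: worst_case_def)
qed

end

theory Submission
  imports Defs "HOL-Real_Asymp.Real_Asymp"
begin

text \<open>By Hoelder's inequality and a rank-one matrix attaining it, the vectors \<open>\<Delta> \<beta>\<close> with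
  \<open>\<Delta>\<close> in the uncertainty set fill exactly the \<open>\<ell>\<^sub>q\<close> ball of radius \<open>r = \<rho> \<parallel>\<beta>\<parallel>\<close> (conjugate norm), so the
  worst case is the maximum of \<open>\<parallel>z + u\<parallel>\<^sub>p\<close> over that ball. The upper bound is the triangle inequality;
  for \<open>p = 1, \<infinity>\<close> the signs of a maximizer \<open>u\<close> can be aligned with \<open>z\<close>, whereas for \<open>1 < p < \<infinity>\<close>
  strict convexity forces \<open>z\<close> to be proportional to a maximizer of \<open>\<parallel>u\<parallel>\<^sub>p\<close> on the \<open>\<ell>\<^sub>q\<close> sphere, of which
  there are finitely many. The lower bound takes \<open>u\<close> parallel to \<open>z\<close>. Its gap tends to \<open>0\<close> along
  \<open>z = t e\<^sub>k\<close> if \<open>p \<le> q\<close> and along \<open>z = (t, \<dots>, t)\<close> if \<open>q < p\<close>, as \<open>t \<rightarrow> \<infinity>\<close>; all estimates rest on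
  \<open>x \<mapsto> x\<^sup>s\<close> lying above its tangents.\<close>

subsection \<open>Inequalities for \<open>\<ell>\<^sub>p\<close> norms\<close>

lemma exponent_cases:
  fixes p :: ennreal
  assumes "1 \<le> p"
  obtains "p = top" | a where "1 \<le> a" "p = ennreal a"
  using assms by (cases p) auto

lemma lp_fam_ennreal:
  "0 \<le> a \<Longrightarrow> lp_fam (ennreal a) f = (\<Sum>i\<in>UNIV. \<bar>f i\<bar> powr a) powr (1 / a)"
  by (simp add: lp_fam_def)

lemma lp_fam_top: "lp_fam top f = Max (range (\<lambda>i. \<bar>f i\<bar>))"
  by (simp add: lp_fam_def)

lemma lp_fam_1: "lp_fam 1 f = (\<Sum>i\<in>UNIV. \<bar>f i\<bar>)"
  by (simp add: lp_fam_def sum_nonneg)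

lemma lp_fam_nonneg: "1 \<le> p \<Longrightarrow> 0 \<le> lp_fam p f"
  using abs_le_lp_fam[of p f] by (meson abs_ge_zero order_trans)

lemma lp_fam_powr:
  assumes "1 \<le> a"
  shows "lp_fam (ennreal a) f powr a = (\<Sum>i\<in>UNIV. \<bar>f i\<bar> powr a)"
  using assms by (simp add: lp_fam_ennreal powr_powr sum_nonneg)

lemma lp_fam_top_le_iff: "lp_fam top f \<le> c \<longleftrightarrow> (\<forall>i. \<bar>f i\<bar> \<le> c)"
  unfolding lp_fam_top by (subst Max_le_iff) auto

lemma powr_le_iff:
  fixes x y a :: real
  assumes "0 < a" "0 \<le> x" "0 \<le> y"
  shows "x powr a \<le> y powr a \<longleftrightarrow> x \<le> y"
  using assms powr_mono2[of a x y] powr_less_mono2[of a y x] by (meson leD leI less_imp_le)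

text \<open>The map x |-> x^a is monotone, so norms may be compared through their
  \<open>a\<close>-th powers. Later estimates then work with sums of powers and never with the outer
  root.\<close>

lemma lp_fam_le_iff:
  assumes "1 \<le> a" "0 \<le> c"
  shows "lp_fam (ennreal a) f \<le> c \<longleftrightarrow> (\<Sum>i\<in>UNIV. \<bar>f i\<bar> powr a) \<le> c powr a"
  unfolding lp_fam_powr[OF assms(1), symmetric]
  using assms lp_fam_nonneg[of "ennreal a" f] by (simp add: powr_le_iff)

lemma lp_fam_eq_iff:
  assumes "1 \<le> a" "0 \<le> c"
  shows "lp_fam (ennreal a) f = c \<longleftrightarrow> (\<Sum>i\<in>UNIV. \<bar>f i\<bar> powr a) = c powr a"
  unfolding lp_fam_powr[OF assms(1), symmetric]
  using assms lp_fam_nonneg[of "ennreal a" f]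
  by (simp add: eq_iff powr_le_iff)

lemma lp_fam_eq_0_iff:
  assumes "1 \<le> p"
  shows "lp_fam p f = 0 \<longleftrightarrow> (\<forall>i. f i = 0)"
proof
  assume "lp_fam p f = 0"
  then show "\<forall>i. f i = 0" using abs_le_lp_fam[OF assms, of f] by auto
next
  assume "\<forall>i. f i = 0"
  then have "f = (\<lambda>i. 0)" by auto
  then show "lp_fam p f = 0" by (simp add: lp_fam_zero)
qed

lemma lp_fam_mono:
  assumes "1 \<le> p" "\<And>i. \<bar>f i\<bar> \<le> \<bar>g i\<bar>"
  shows "lp_fam p f \<le> lp_fam p g"
  using assms(1)
proof (cases p rule: exponent_cases)
  case 1
  then show ?thesis
    using assms abs_le_lp_fam[of p g] by (metis lp_fam_top_le_iff order_trans)
next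
  case (2 a)
  then show ?thesis
    using assms by (simp add: lp_fam_le_iff lp_fam_nonneg lp_fam_powr sum_mono powr_mono2)
qed

lemma lp_fam_abs: "1 \<le> p \<Longrightarrow> lp_fam p (\<lambda>i. \<bar>f i\<bar>) = lp_fam p f"
  by (intro antisym lp_fam_mono) auto

lemma lp_fam_scale:
  assumes "1 \<le> p"
  shows "lp_fam p (\<lambda>i. c * f i) = \<bar>c\<bar> * lp_fam p f"
  using assms
proof (cases p rule: exponent_cases)
  case 1
  have "Max ((\<lambda>x. \<bar>c\<bar> * x) ` range (\<lambda>i. \<bar>f i\<bar>)) = \<bar>c\<bar> * Max (range (\<lambda>i. \<bar>f i\<bar>))"
    by (rule mono_Max_commute[symmetric]) (auto intro!: monoI mult_left_mono)
  then show ?thesis using 1 by (simp add: lp_fam_top abs_mult image_image)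
next
  case (2 a)
  then have "\<bar>c\<bar> = (\<bar>c\<bar> powr a) powr (1 / a)" by (simp add: powr_powr)
  moreover from 2 have "lp_fam p (\<lambda>i. c * f i)
      = (\<bar>c\<bar> powr a) powr (1 / a) * (\<Sum>i\<in>UNIV. \<bar>f i\<bar> powr a) powr (1 / a)"
    by (simp add: lp_fam_ennreal abs_mult powr_mult sum_nonneg flip: sum_distrib_left)
  ultimately show ?thesis using 2 by (simp add: lp_fam_ennreal)
qed

section \<open>Tangent inequalities, strict convexity and Minkowski's inequality\<close>

text \<open>By the mean value theorem, y^s - c^s is (y - c) times the derivative at a point strictly
  between \<open>c\<close> and \<open>y\<close>, and the derivative is strictly increasing. The
  endpoint y = 0 is computed directly because the derivative formula is set up for positive
  arguments.\<close>

lemma powr_above_tangent_strict: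
  fixes s c y :: real
  assumes "1 < s" "0 < c" "0 \<le> y" "y \<noteq> c"
  shows "c powr s + s * c powr (s - 1) * (y - c) < y powr s"
proof (cases "y = 0")
  case True
  have "c powr (s - 1) * c = c powr s"
    using assms powr_add[of c "s - 1" 1] by simp
  then have "c powr s + s * c powr (s - 1) * (0 - c) = (1 - s) * c powr s"
    by (simp add: algebra_simps)
  also have "\<dots> < 0" using assms by (intro mult_neg_pos) auto
  finally show ?thesis using True by simp
next
  case False
  have d: "((\<lambda>x. x powr s) has_real_derivative s * x powr (s - 1)) (at x)" if "0 < x" for x
    using that by (auto intro!: derivative_eq_intros)
  show ?thesis
  proof (cases "c < y")
    case True
    then obtain \<xi> where x: "c < \<xi>" "\<xi> < y" "y powr s - c powr s = (y - c) * (s * \<xi> powr (s - 1))"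
      using MVT2[of c y "\<lambda>x. x powr s" "\<lambda>x. s * x powr (s - 1)"] d assms by fastforce
    have "c powr (s - 1) < \<xi> powr (s - 1)" using x assms by (intro powr_less_mono2) auto
    then have "(y - c) * (s * c powr (s - 1)) < (y - c) * (s * \<xi> powr (s - 1))"
      using assms True by simp
    with x show ?thesis by (simp add: algebra_simps)
  next
    case F: False
    then obtain \<xi> where x: "y < \<xi>" "\<xi> < c" "c powr s - y powr s = (c - y) * (s * \<xi> powr (s - 1))"
      using MVT2[of y c "\<lambda>x. x powr s" "\<lambda>x. s * x powr (s - 1)"] d assms False by fastforce
    have "\<xi> powr (s - 1) < c powr (s - 1)" using x assms False by (intro powr_less_mono2) auto
    then have "(c - y) * (s * \<xi> powr (s - 1)) < (c - y) * (s * c powr (s - 1))"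
      using assms F by simp
    with x show ?thesis by (simp add: algebra_simps)
  qed
qed

lemma powr_above_tangent:
  fixes s c y :: real
  assumes "1 \<le> s" "0 < c" "0 \<le> y"
  shows "c powr s + s * c powr (s - 1) * (y - c) \<le> y powr s"
  using powr_above_tangent_strict[of s c y] assms by (cases "s = 1"; cases "y = c") auto

text \<open>The subgradient is 0 at c = 0 and s |c|^(s-1) sgn c elsewhere. The values at y = -c and
  y = c tie, so there strictness comes from the slope term; for |y| different from |c|, the estimate
  sgn c * (y - c) <= |y| - |c| reduces to nonnegative arguments.\<close>

lemma abs_powr_above_tangent_strict:
  fixes s c :: real
  assumes "1 < s"
  shows "\<exists>g. \<forall>y. y \<noteq> c \<longrightarrow> \<bar>c\<bar> powr s + g * (y - c) < \<bar>y\<bar> powr s"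
proof (cases "c = 0")
  case True
  then show ?thesis using assms by (auto intro!: exI[of _ 0])
next
  case False
  let ?g = "s * \<bar>c\<bar> powr (s - 1)"
  have "\<bar>c\<bar> powr s + ?g * sgn c * (y - c) < \<bar>y\<bar> powr s" if "y \<noteq> c" for y
  proof (cases "\<bar>y\<bar> = \<bar>c\<bar>")
    case True
    then have "sgn c * (y - c) < 0" using that by (auto simp: sgn_if abs_if split: if_splits)
    from mult_pos_neg[OF _ this, of ?g] have "?g * (sgn c * (y - c)) < 0" using assms False by simp
    then show ?thesis unfolding True by (simp only: mult.assoc)
  next
    case F: False
    have "sgn c * (y - c) \<le> \<bar>y\<bar> - \<bar>c\<bar>" by (auto simp: sgn_if abs_if)
    then have "?g * (sgn c * (y - c)) \<le> ?g * (\<bar>y\<bar> - \<bar>c\<bar>)"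
      using assms by (intro mult_left_mono) auto
    also have "\<dots> < \<bar>y\<bar> powr s - \<bar>c\<bar> powr s"
      using powr_above_tangent_strict[of s "\<bar>c\<bar>" "\<bar>y\<bar>"] F False assms by simp
    finally show ?thesis by (simp only: mult.assoc less_diff_eq add.commute)
  qed
  then show ?thesis by blast
qed

text \<open>The two subgradient inequalities at the convex combination \<open>c\<close> are averaged
  with weights \<open>\<mu>\<close> and 1 - \<open>\<mu>\<close>; the linear terms cancel.\<close>

lemma abs_powr_strict_convex:
  fixes s x y \<mu> :: real
  assumes "1 < s" "0 < \<mu>" "\<mu> < 1" "x \<noteq> y"
  shows "\<bar>\<mu> * x + (1 - \<mu>) * y\<bar> powr s < \<mu> * \<bar>x\<bar> powr s + (1 - \<mu>) * \<bar>y\<bar> powr s"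
proof -
  define c where "c = \<mu> * x + (1 - \<mu>) * y"
  obtain g where g: "\<And>t. t \<noteq> c \<Longrightarrow> \<bar>c\<bar> powr s + g * (t - c) < \<bar>t\<bar> powr s"
    using abs_powr_above_tangent_strict[OF assms(1)] by blast
  have e: "x - c = (1 - \<mu>) * (x - y)" "y - c = \<mu> * (y - x)" by (auto simp: c_def algebra_simps)
  then have "x \<noteq> c" "y \<noteq> c" using assms by auto
  then have "\<mu> * (\<bar>c\<bar> powr s + g * (x - c)) < \<mu> * \<bar>x\<bar> powr s"
    "(1 - \<mu>) * (\<bar>c\<bar> powr s + g * (y - c)) < (1 - \<mu>) * \<bar>y\<bar> powr s"
    using g assms by auto
  moreover have "\<mu> * (\<bar>c\<bar> powr s + g * (x - c)) + (1 - \<mu>) * (\<bar>c\<bar> powr s + g * (y - c)) = \<bar>c\<bar> powr s"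
    unfolding e by (simp add: algebra_simps)
  ultimately show ?thesis unfolding c_def by linarith
qed

text \<open>With A and B the norms of \<open>f\<close> and \<open>g\<close>, (f + g) / (A + B) is
  the convex combination of the unit families f / A and g / B with weight A / (A + B). Convexity in
  every coordinate bounds its sum of powers by 1, and the bound is strict because the normalized
  families differ at \<open>k\<close>.\<close>

lemma lp_fam_triangle_strict:
  fixes f g :: "'i::finite \<Rightarrow> real"
  assumes "1 < a" and f: "0 < lp_fam (ennreal a) f" and g: "0 < lp_fam (ennreal a) g"
    and ne: "lp_fam (ennreal a) g * f k \<noteq> lp_fam (ennreal a) f * g k"
  shows "lp_fam (ennreal a) (\<lambda>i. f i + g i) < lp_fam (ennreal a) f + lp_fam (ennreal a) g"
proof -
  define A B where "A = lp_fam (ennreal a) f" and "B = lp_fam (ennreal a) g"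
  define \<mu> where "\<mu> = A / (A + B)"
  have AB: "0 < A" "0 < B" using f g by (auto simp: A_def B_def)
  then have m: "0 < \<mu>" "\<mu> < 1" by (auto simp: \<mu>_def)
  have m': "\<mu> * (f i / A) + (1 - \<mu>) * (g i / B) = (f i + g i) / (A + B)" for i
  proof -
    have "1 - \<mu> = B / (A + B)" using AB by (simp add: \<mu>_def field_simps)
    then show ?thesis using AB by (simp add: \<mu>_def add_divide_distrib)
  qed
  have le: "\<bar>\<mu> * x + (1 - \<mu>) * y\<bar> powr a \<le> \<mu> * \<bar>x\<bar> powr a + (1 - \<mu>) * \<bar>y\<bar> powr a" for x y
    using abs_powr_strict_convex[OF \<open>1 < a\<close> m, of x y] by (cases "x = y") (auto simp: algebra_simps)
  have k: "f k / A \<noteq> g k / B" using ne AB by (simp add: A_def B_def field_simps)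
  have unit: "(\<Sum>i\<in>UNIV. \<bar>h i / lp_fam (ennreal a) h\<bar> powr a) = 1" if "0 < lp_fam (ennreal a) h"
    for h :: "'i \<Rightarrow> real"
  proof -
    have "(\<Sum>i\<in>UNIV. \<bar>h i / lp_fam (ennreal a) h\<bar> powr a)
        = (\<Sum>i\<in>UNIV. \<bar>h i\<bar> powr a) / lp_fam (ennreal a) h powr a"
      using that by (simp add: powr_divide sum_divide_distrib)
    also have "\<dots> = 1" using that \<open>1 < a\<close> by (simp flip: lp_fam_powr)
    finally show ?thesis .
  qed
  have "(\<Sum>i\<in>UNIV. \<bar>f i + g i\<bar> powr a)
      = (A + B) powr a * (\<Sum>i\<in>UNIV. \<bar>(f i + g i) / (A + B)\<bar> powr a)"
    using AB by (simp add: powr_divide flip: sum_divide_distrib)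
  also have "\<dots> < (A + B) powr a *
      (\<Sum>i\<in>UNIV. \<mu> * \<bar>f i / A\<bar> powr a + (1 - \<mu>) * \<bar>g i / B\<bar> powr a)"
  proof (rule mult_strict_left_mono)
    show "(\<Sum>i\<in>UNIV. \<bar>(f i + g i) / (A + B)\<bar> powr a)
        < (\<Sum>i\<in>UNIV. \<mu> * \<bar>f i / A\<bar> powr a + (1 - \<mu>) * \<bar>g i / B\<bar> powr a)"
      unfolding m'[symmetric]
      by (rule sum_strict_mono_ex1)
        (use le abs_powr_strict_convex[OF \<open>1 < a\<close> m k] in \<open>auto simp del: times_divide_eq_right abs_divide\<close>)
  qed (use AB in auto)
  also have "(\<Sum>i\<in>UNIV. \<mu> * \<bar>f i / A\<bar> powr a + (1 - \<mu>) * \<bar>g i / B\<bar> powr a) = 1"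
    using unit[OF f] unit[OF g] by (simp add: sum.distrib A_def B_def flip: sum_distrib_left)
  finally have "lp_fam (ennreal a) (\<lambda>i. f i + g i) powr a < (A + B) powr a"
    using \<open>1 < a\<close> by (simp add: lp_fam_powr)
  then have "lp_fam (ennreal a) (\<lambda>i. f i + g i) < A + B"
    using AB \<open>1 < a\<close> powr_mono2[of a "A + B" "lp_fam (ennreal a) (\<lambda>i. f i + g i)"] by fastforce
  then show ?thesis by (simp add: A_def B_def)
qed

text \<open>For finite exponents above 1 the strict version settles all pairs that are not
  proportional. If \<open>g\<close> is a nonnegative multiple of \<open>f\<close>, homogeneity gives
  equality.\<close>

lemma lp_fam_triangle:
  fixes f g :: "'i::finite \<Rightarrow> real"
  assumes "1 \<le> p"
  shows "lp_fam p (\<lambda>i. f i + g i) \<le> lp_fam p f + lp_fam p g"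
  using assms
proof (cases p rule: exponent_cases)
  case 1
  show ?thesis unfolding 1 lp_fam_top_le_iff
    using abs_le_lp_fam[of top f] abs_le_lp_fam[of top g]
    by (auto intro: order_trans[OF abs_triangle_ineq] add_mono)
next
  case (2 a)
  show ?thesis
  proof (cases "a = 1")
    case True
    then show ?thesis using 2 by (auto simp: lp_fam_1 simp flip: sum.distrib intro!: sum_mono)
  next
    case False
    consider "\<forall>i. f i = 0" | "\<forall>i. g i = 0" | "0 < lp_fam p f" "0 < lp_fam p g"
      using lp_fam_eq_0_iff[OF assms, of f] lp_fam_eq_0_iff[OF assms, of g]
        lp_fam_nonneg[OF assms, of f] lp_fam_nonneg[OF assms, of g] by (metis less_eq_real_def)
    then show ?thesis
    proof cases
      case 3
      show ?thesis
      proof (cases "\<exists>k. lp_fam p g * f k \<noteq> lp_fam p f * g k")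
        case True
        then show ?thesis using lp_fam_triangle_strict[of a f g] 3 2 False by fastforce
      next
        case F: False
        then have "g i = lp_fam p g / lp_fam p f * f i" for i using 3 by (simp add: field_simps)
        then have "(\<lambda>i. f i + g i) = (\<lambda>i. (1 + lp_fam p g / lp_fam p f) * f i)"
          by (auto simp: algebra_simps)
        then have "lp_fam p (\<lambda>i. f i + g i) = (1 + lp_fam p g / lp_fam p f) * lp_fam p f"
          using 3 by (simp only: lp_fam_scale[OF assms]) simp
        also have "\<dots> = lp_fam p f + lp_fam p g" using 3 by (simp add: distrib_right)
        finally show ?thesis by simp
      qed
    qed (simp_all add: lp_fam_nonneg assms)
  qed
qed

section \<open>Conjugate exponents, Hoelder's inequality and its sharpness\<close>

lemma conj_exponent_1: "conj_exponent 1 = top"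
  by (simp add: conj_exponent_def)

lemma conj_exponent_top: "conj_exponent top = 1"
  by (simp add: conj_exponent_def)

lemma conj_exponent_ennreal:
  assumes "1 < a"
  shows "conj_exponent (ennreal a) = ennreal (a / (a - 1))"
proof -
  have "inverse (1 - ennreal (1 / a)) = inverse (ennreal (1 - 1 / a))"
    using assms by (metis ennreal_1 ennreal_minus divide_nonneg_nonneg le_less less_trans zero_less_one)
  also have "\<dots> = ennreal (inverse (1 - 1 / a))" using assms by (subst inverse_ennreal) auto
  also have "inverse (1 - 1 / a) = a / (a - 1)" using assms by (simp add: field_simps)
  finally show ?thesis
    using assms by (simp add: conj_exponent_def inverse_ennreal inverse_eq_divide)
qed

text \<open>At the endpoints one factor is replaced by its maximum. In between, Young's inequality
  is applied to the normalized entries |f i| / A and |g i| / B and summed, giving 1/a + 1/b =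
  1.\<close>

lemma lp_fam_Hoelder:
  fixes f g :: "'i::finite \<Rightarrow> real"
  assumes "1 \<le> q"
  shows "\<bar>\<Sum>i\<in>UNIV. f i * g i\<bar> \<le> lp_fam q f * lp_fam (conj_exponent q) g"
proof -
  have c: "1 \<le> conj_exponent q" by (rule conj_exponent[OF assms])
  have abs: "\<bar>\<Sum>i\<in>UNIV. f i * g i\<bar> \<le> (\<Sum>i\<in>UNIV. \<bar>f i\<bar> * \<bar>g i\<bar>)"
    by (rule order_trans[OF sum_abs]) (simp add: abs_mult)
  from assms show ?thesis
  proof (cases q rule: exponent_cases)
    case 1
    have "(\<Sum>i\<in>UNIV. \<bar>f i\<bar> * \<bar>g i\<bar>) \<le> (\<Sum>i\<in>UNIV. lp_fam q f * \<bar>g i\<bar>)"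
      by (intro sum_mono mult_right_mono abs_le_lp_fam assms) auto
    with abs 1 show ?thesis by (simp add: conj_exponent_top lp_fam_1 flip: sum_distrib_left)
  next
    case (2 a)
    show ?thesis
    proof (cases "a = 1")
      case True
      have "(\<Sum>i\<in>UNIV. \<bar>f i\<bar> * \<bar>g i\<bar>) \<le> (\<Sum>i\<in>UNIV. \<bar>f i\<bar> * lp_fam (conj_exponent q) g)"
        by (intro sum_mono mult_left_mono abs_le_lp_fam c) auto
      with abs 2 True show ?thesis by (simp add: conj_exponent_1 lp_fam_1 flip: sum_distrib_right)
    next
      case False
      define b where "b = a / (a - 1)"
      have ab: "1 < a" "1 < b" "1 / a + 1 / b = 1" using 2 False by (auto simp: b_def field_simps)
      have q: "q = ennreal a" "conj_exponent q = ennreal b"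
        using 2 conj_exponent_ennreal[OF ab(1)] by (auto simp: b_def)
      define A B where "A = lp_fam q f" and "B = lp_fam (conj_exponent q) g"
      show ?thesis
      proof (cases "A = 0 \<or> B = 0")
        case True
        then have "(\<Sum>i\<in>UNIV. f i * g i) = 0"
          using lp_fam_eq_0_iff[OF assms, of f] lp_fam_eq_0_iff[OF c, of g]
          by (auto simp: A_def B_def)
        then show ?thesis by (simp add: lp_fam_nonneg assms c)
      next
        case False
        then have AB: "0 < A" "0 < B"
          using lp_fam_nonneg[OF assms, of f] lp_fam_nonneg[OF c, of g] by (auto simp: A_def B_def)
        have "(\<Sum>i\<in>UNIV. \<bar>f i\<bar> / A * (\<bar>g i\<bar> / B))
            \<le> (\<Sum>i\<in>UNIV. (\<bar>f i\<bar> / A) powr a / a + (\<bar>g i\<bar> / B) powr b / b)"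
          using AB ab by (intro sum_mono Youngs_inequality) auto
        also have "\<dots> = (\<Sum>i\<in>UNIV. \<bar>f i\<bar> powr a) / A powr a / a + (\<Sum>i\<in>UNIV. \<bar>g i\<bar> powr b) / B powr b / b"
          using AB by (simp add: powr_divide sum.distrib sum_divide_distrib)
        also have "\<dots> = A powr a / A powr a / a + B powr b / B powr b / b"
          unfolding A_def B_def q(2) unfolding q(1) using ab by (simp add: lp_fam_powr)
        also have "\<dots> = 1" using AB ab by simp
        finally have "(\<Sum>i\<in>UNIV. \<bar>f i\<bar> * \<bar>g i\<bar>) / (A * B) \<le> 1"
          by (simp add: sum_divide_distrib)
        then have "(\<Sum>i\<in>UNIV. \<bar>f i\<bar> * \<bar>g i\<bar>) \<le> A * B" using AB by (simp add: field_simps)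
        with abs show ?thesis by (simp add: A_def B_def)
      qed
    qed
  qed
qed

text \<open>The extremizer is the sign pattern of \<open>g\<close> for q = infinity, one signed
  coordinate of largest modulus for q = 1, and sgn(g) (|g| / B)^(b-1) otherwise. The norm is only
  asserted to be at most 1 so that \<open>g\<close> = 0 fits as well.\<close>

lemma lp_fam_dual_attained:
  fixes g :: "'i::finite \<Rightarrow> real"
  assumes "1 \<le> q"
  shows "\<exists>v. lp_fam q v \<le> 1 \<and> (\<Sum>i\<in>UNIV. v i * g i) = lp_fam (conj_exponent q) g"
  using assms
proof (cases q rule: exponent_cases)
  case 1
  have "lp_fam top (\<lambda>i. sgn (g i)) \<le> 1" unfolding lp_fam_top_le_iff by (simp add: abs_sgn_eq)
  moreover have "(\<Sum>i\<in>UNIV. sgn (g i) * g i) = lp_fam 1 g"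
    by (simp add: lp_fam_1 abs_sgn mult.commute)
  ultimately show ?thesis using 1 by (auto simp: conj_exponent_top)
next
  case (2 a)
  show ?thesis
  proof (cases "a = 1")
    case True
    have "lp_fam top g \<in> range (\<lambda>i. \<bar>g i\<bar>)" unfolding lp_fam_top by (rule Max_in) auto
    then obtain k where k: "lp_fam top g = \<bar>g k\<bar>" by auto
    let ?v = "\<lambda>i. if i = k then sgn (g k) else 0"
    have "(\<Sum>i\<in>UNIV. \<bar>?v i\<bar>) = \<bar>sgn (g k)\<bar>" by (simp add: if_distrib[of abs] cong: if_cong)
    then have "lp_fam 1 ?v \<le> 1" by (simp add: lp_fam_1 sgn_if)
    moreover
    have "(\<Sum>i\<in>UNIV. ?v i * g i) = sgn (g k) * g k"
      by (simp add: if_distrib[of "\<lambda>x. x * _"] cong: if_cong)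
    then have "(\<Sum>i\<in>UNIV. ?v i * g i) = \<bar>g k\<bar>" by (simp add: abs_sgn mult.commute)
    ultimately show ?thesis using True 2 k by (auto simp: conj_exponent_1)
  next
    case False
    define b where "b = a / (a - 1)"
    \<comment> \<open>The identity (b - 1) a = b turns the \<open>a\<close>-th powers of the
      extremizer into normalized \<open>b\<close>-th powers of \<open>g\<close>, which sum to
      1.\<close>
    have ab: "1 < a" "1 < b" "(b - 1) * a = b" using 2 False by (auto simp: b_def field_simps)
    have q: "q = ennreal a" "conj_exponent q = ennreal b"
      using 2 conj_exponent_ennreal[OF ab(1)] by (auto simp: b_def)
    define B where "B = lp_fam (ennreal b) g"
    show ?thesis
    proof (cases "B = 0")
      case True
      then show ?thesis
        using q by (intro exI[of _ "\<lambda>i. 0"]) (simp add: B_def lp_fam_zero)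
    next
      case False
      then have B: "0 < B" using lp_fam_nonneg[of "ennreal b" g] ab by (simp add: B_def)
      have S: "(\<Sum>i\<in>UNIV. \<bar>g i\<bar> powr b) = B powr b" using ab by (simp add: B_def lp_fam_powr)
      let ?v = "\<lambda>i. sgn (g i) * (\<bar>g i\<bar> / B) powr (b - 1)"
      have "\<bar>?v i\<bar> powr a = \<bar>g i\<bar> powr b / B powr b" for i
        using B ab by (cases "g i = 0") (auto simp: abs_mult powr_powr powr_divide abs_sgn_eq)
      then have "(\<Sum>i\<in>UNIV. \<bar>?v i\<bar> powr a) = 1"
        using B by (simp add: S flip: sum_divide_distrib)
      then have le: "lp_fam q ?v \<le> 1" using ab q by (simp add: lp_fam_ennreal)
      have "?v i * g i = \<bar>g i\<bar> powr b / B powr (b - 1)" for i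
      proof (cases "g i = 0")
        case F: False
        have "?v i * g i = \<bar>g i\<bar> * \<bar>g i\<bar> powr (b - 1) / B powr (b - 1)"
          using B by (simp add: powr_divide abs_sgn mult_ac)
        also have "\<bar>g i\<bar> * \<bar>g i\<bar> powr (b - 1) = \<bar>g i\<bar> powr b"
          using F powr_add[of "\<bar>g i\<bar>" 1 "b - 1"] by simp
        finally show ?thesis .
      qed auto
      then have "(\<Sum>i\<in>UNIV. ?v i * g i) = B powr b / B powr (b - 1)"
        by (simp add: S flip: sum_divide_distrib)
      also have "\<dots> = B" using B powr_diff[of B b "b - 1"] by simp
      finally show ?thesis using le q by (auto simp: B_def)
    qed
  qed
qed

text \<open>An entrywise matrix norm is the norm of the vector of row norms, which allows Hoelder's
  inequality to be used row by row and makes the norm of a rank-one matrix factor.\<close>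

lemma lp_fam_iterated:
  fixes F :: "'i::finite \<Rightarrow> 'j::finite \<Rightarrow> real"
  assumes "1 \<le> q"
  shows "lp_fam q (\<lambda>(i, j). F i j) = lp_fam q (\<lambda>i. lp_fam q (F i))"
  using assms
proof (cases q rule: exponent_cases)
  case 1
  show ?thesis
  proof (rule antisym)
    show "lp_fam q (\<lambda>(i, j). F i j) \<le> lp_fam q (\<lambda>i. lp_fam q (F i))"
      unfolding 1 lp_fam_top_le_iff
      using order_trans[OF abs_le_lp_fam[of top "F _"]
          order_trans[OF abs_ge_self abs_le_lp_fam[of top "\<lambda>i. lp_fam top (F i)"]]] by auto
    show "lp_fam q (\<lambda>i. lp_fam q (F i)) \<le> lp_fam q (\<lambda>(i, j). F i j)"
      unfolding 1 lp_fam_top_le_iff using abs_le_lp_fam[of top "\<lambda>(i, j). F i j"]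
      by (auto simp: lp_fam_nonneg lp_fam_top_le_iff)
  qed
next
  case (2 a)
  then have "(\<Sum>i\<in>UNIV. \<bar>lp_fam q (F i)\<bar> powr a) = (\<Sum>i\<in>UNIV. \<Sum>j\<in>UNIV. \<bar>F i j\<bar> powr a)"
    by (simp add: lp_fam_nonneg lp_fam_powr)
  also have "\<dots> = (\<Sum>x\<in>UNIV. \<bar>case x of (i, j) \<Rightarrow> F i j\<bar> powr a)"
    by (simp add: sum.cartesian_product UNIV_Times_UNIV case_prod_unfold)
  finally show ?thesis using 2 by (simp add: lp_fam_ennreal)
qed

subsection \<open>The worst case as a maximum over a ball\<close>

lemma lp_norm_nonneg: "1 \<le> p \<Longrightarrow> 0 \<le> lp_norm p x"
  by (simp add: lp_norm_def lp_fam_nonneg)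

lemma lp_norm_eq_0_iff: "1 \<le> p \<Longrightarrow> lp_norm p x = 0 \<longleftrightarrow> x = 0"
  by (simp add: lp_norm_def lp_fam_eq_0_iff vec_eq_iff)

lemma lp_norm_pos_iff: "1 \<le> p \<Longrightarrow> 0 < lp_norm p x \<longleftrightarrow> x \<noteq> 0"
  using lp_norm_nonneg[of p x] lp_norm_eq_0_iff[of p x] by auto

lemma lp_norm_scaleR: "1 \<le> p \<Longrightarrow> lp_norm p (c *\<^sub>R x) = \<bar>c\<bar> * lp_norm p x"
  by (simp add: lp_norm_def lp_fam_scale)

lemma lp_norm_triangle: "1 \<le> p \<Longrightarrow> lp_norm p (x + y) \<le> lp_norm p x + lp_norm p y"
  by (simp add: lp_norm_def lp_fam_triangle)

lemma lp_fam_abs_cong: "1 \<le> p \<Longrightarrow> (\<And>i. \<bar>f i\<bar> = \<bar>g i\<bar>) \<Longrightarrow> lp_fam p f = lp_fam p g"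
  by (intro antisym lp_fam_mono) auto

text \<open>Contrapositive of the strict triangle inequality: equality makes all coordinates
  proportional with the ratio of the norms. The case z = 0 takes the factor 0.\<close>

lemma lp_norm_triangle_eq:
  assumes "1 < a" "u \<noteq> 0" "lp_norm (ennreal a) (z + u) = lp_norm (ennreal a) z + lp_norm (ennreal a) u"
  shows "\<exists>c. z = c *\<^sub>R u"
proof (cases "z = 0")
  case True
  then show ?thesis by (auto intro: exI[of _ 0])
next
  case False
  let ?N = "lp_norm (ennreal a)"
  have a: "1 \<le> ennreal a" using assms by simp
  have pos: "0 < ?N u" "0 < ?N z" using False assms lp_norm_pos_iff[OF a] by auto
  have "?N u * z $ k = ?N z * u $ k" for k
    using lp_fam_triangle_strict[OF assms(1), of "($) z" "($) u" k] pos assms(3)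
    by (auto simp: lp_norm_def)
  then have "z = (?N z / ?N u) *\<^sub>R u" using pos by (simp add: vec_eq_iff field_simps)
  then show ?thesis by blast
qed

lemma lp_fam_outer_product:
  assumes "1 \<le> q"
  shows "lp_fam q (\<lambda>(i, j). f i * g j) = lp_fam q f * lp_fam q g"
proof -
  have "lp_fam q (\<lambda>(i, j). f i * g j) = lp_fam q (\<lambda>i. lp_fam q g * \<bar>f i\<bar>)"
    by (simp add: lp_fam_iterated lp_fam_scale assms mult.commute)
  then show ?thesis
    by (simp only: lp_fam_scale[OF assms] lp_fam_abs[OF assms]) (simp add: lp_fam_nonneg assms)
qed

text \<open>Hoelder's inequality bounds every entry of the product by the row norm times B, where B
  is the conjugate norm of \<open>\<beta>\<close>. Conversely, if \<open>v\<close> is dual to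
  \<open>\<beta>\<close>, the matrix with entries (u_i / B) v_j maps \<open>\<beta>\<close> to
  \<open>u\<close>, and its norm is the product of two vector norms. If B = 0, then \<open>u\<close>
  = 0 and the zero matrix serves.\<close>

lemma uncertainty_set_image:
  fixes \<beta> :: "real ^ 'n"
  assumes "0 \<le> \<rho>" "1 \<le> q"
  shows "(\<lambda>\<Delta>. \<Delta> *v \<beta>) ` (uncertainty_set \<rho> q :: (real ^ 'n ^ 'm) set)
    = {u. lp_norm q u \<le> \<rho> * lp_norm (conj_exponent q) \<beta>}"
proof (intro subset_antisym subsetI)
  let ?B = "lp_norm (conj_exponent q) \<beta>"
  have c: "1 \<le> conj_exponent q" by (rule conj_exponent[OF assms(2)])
  have B: "0 \<le> ?B" by (rule lp_norm_nonneg[OF c])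
  {
    fix u :: "real ^ 'm"
    assume "u \<in> (\<lambda>\<Delta>. \<Delta> *v \<beta>) ` (uncertainty_set \<rho> q :: (real ^ 'n ^ 'm) set)"
    then obtain \<Delta> :: "real ^ 'n ^ 'm" where D: "u = \<Delta> *v \<beta>" "F_norm q \<Delta> \<le> \<rho>"
      by (auto simp: uncertainty_set_def)
    have "\<bar>u $ i\<bar> \<le> \<bar>?B * lp_fam q (($) (\<Delta> $ i))\<bar>" for i
      using lp_fam_Hoelder[OF assms(2), of "($) (\<Delta> $ i)" "($) \<beta>"] B
      by (simp add: D matrix_vector_mult_def lp_norm_def lp_fam_nonneg assms mult.commute)
    then have "lp_norm q u \<le> lp_fam q (\<lambda>i. ?B * lp_fam q (($) (\<Delta> $ i)))"
      unfolding lp_norm_def by (intro lp_fam_mono assms) 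
    also have "\<dots> = ?B * F_norm q \<Delta>"
      using B by (simp add: lp_fam_scale assms F_norm_def lp_fam_iterated)
    also have "\<dots> \<le> ?B * \<rho>" using B D by (intro mult_left_mono)
    finally show "u \<in> {u. lp_norm q u \<le> \<rho> * ?B}" by (simp add: mult.commute)
  }
  {
    fix u :: "real ^ 'm"
    assume "u \<in> {u. lp_norm q u \<le> \<rho> * ?B}"
    then have u: "lp_norm q u \<le> \<rho> * ?B" by simp
    show "u \<in> (\<lambda>\<Delta>. \<Delta> *v \<beta>) ` (uncertainty_set \<rho> q :: (real ^ 'n ^ 'm) set)"
    proof (cases "?B = 0")
      case True
      then have "u = 0" using u lp_norm_nonneg[OF assms(2), of u] lp_norm_eq_0_iff[OF assms(2), of u]
        by simp
      then show ?thesis using assms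
        by (intro image_eqI[of _ _ 0])
          (auto simp: uncertainty_set_def F_norm_def case_prod_unfold lp_fam_zero)
    next
      case False
      obtain v where v: "lp_fam q v \<le> 1" "(\<Sum>j\<in>UNIV. v j * \<beta> $ j) = ?B"
        using lp_fam_dual_attained[OF assms(2), of "($) \<beta>"] by (auto simp: lp_norm_def)
      define \<Delta> :: "real ^ 'n ^ 'm" where "\<Delta> = (\<chi> i j. (u $ i / ?B) * v j)"
      have "\<Delta> *v \<beta> = u"
        using v(2) False
        by (simp add: \<Delta>_def matrix_vector_mult_def vec_eq_iff mult.assoc flip: sum_distrib_left sum_divide_distrib)
      moreover have F: "F_norm q \<Delta> = lp_norm q ((1 / ?B) *\<^sub>R u) * lp_fam q v"
        using lp_fam_outer_product[OF assms(2), of "\<lambda>i. u $ i / ?B" v]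
        by (simp add: F_norm_def \<Delta>_def lp_norm_def)
      have "F_norm q \<Delta> = lp_fam q v * (lp_norm q u / ?B)"
        unfolding F using B by (simp add: lp_norm_scaleR assms)
      then have "F_norm q \<Delta> \<le> 1 * (\<rho> * ?B / ?B)"
        unfolding \<open>F_norm q \<Delta> = lp_fam q v * (lp_norm q u / ?B)\<close>
        using v u B assms lp_norm_nonneg[OF assms(2), of u]
        by (intro mult_mono divide_right_mono) auto
      then have "\<Delta> \<in> uncertainty_set \<rho> q" using False by (simp add: uncertainty_set_def)
      ultimately show ?thesis by blast
    qed
  }
qed

text \<open>Together with \<open>worst_case_witness\<close> this replaces matrices by vectors
  \<open>u\<close> in a ball; the later arguments use only these two facts about the worst
  case.\<close>

lemma worst_case_ge:
  fixes z :: "real ^ 'm" and \<beta> :: "real ^ 'n"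
  assumes "0 \<le> \<rho>" "1 \<le> p" "1 \<le> q" "lp_norm q u \<le> \<rho> * lp_norm (conj_exponent q) \<beta>"
  shows "lp_norm p (z + u) \<le> worst_case \<rho> p q z \<beta>"
proof -
  have "u \<in> (\<lambda>\<Delta>. \<Delta> *v \<beta>) ` (uncertainty_set \<rho> q :: (real ^ 'n ^ 'm) set)"
    unfolding uncertainty_set_image[OF assms(1,3)] using assms(4) by simp
  then show ?thesis using worst_case_attained[OF assms(1-3), of z \<beta>] by fastforce
qed

lemma worst_case_witness:
  fixes z :: "real ^ 'm" and \<beta> :: "real ^ 'n"
  assumes "0 \<le> \<rho>" "1 \<le> p" "1 \<le> q"
  obtains u where "lp_norm q u \<le> \<rho> * lp_norm (conj_exponent q) \<beta>"
    "worst_case \<rho> p q z \<beta> = lp_norm p (z + u)"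
proof -
  obtain \<Delta> :: "real ^ 'n ^ 'm" where "\<Delta> \<in> uncertainty_set \<rho> q"
    "lp_norm p (z + \<Delta> *v \<beta>) = worst_case \<rho> p q z \<beta>"
    using worst_case_attained[OF assms, of z \<beta>] by blast
  moreover from this have "\<Delta> *v \<beta> \<in> {u. lp_norm q u \<le> \<rho> * lp_norm (conj_exponent q) \<beta>}"
    unfolding uncertainty_set_image[OF assms(1,3), symmetric] by blast
  ultimately show ?thesis using that by auto
qed

section \<open>The discrepancy function and the upper and lower bounds\<close>

lemma lp_norm_le_discrepancy:
  fixes u :: "real ^ 'm"
  assumes "1 \<le> a" "1 \<le> b"
  shows "lp_norm a u \<le> discrepancy TYPE('m) a b * lp_norm b u"
proof (cases "u = 0")
  case True
  then show ?thesis using lp_norm_eq_0_iff[OF assms(1), of u] lp_norm_eq_0_iff[OF assms(2), of u] by simp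
next
  case False
  let ?N = "lp_norm b u"
  have N: "0 < ?N" using False lp_norm_pos_iff[OF assms(2), of u] by simp
  then have "lp_norm b ((1 / ?N) *\<^sub>R u) = 1" by (simp add: lp_norm_scaleR assms del: scaleR_scaleR)
  then have "lp_norm a ((1 / ?N) *\<^sub>R u) \<le> discrepancy TYPE('m) a b"
    using discrepancy_attained[OF assms, where 'm = 'm] by metis
  then show ?thesis using N by (simp add: lp_norm_scaleR assms field_simps)
qed

lemma discrepancy_leI:
  assumes "1 \<le> a" "1 \<le> b" "\<And>u :: real ^ 'm. lp_norm b u = 1 \<Longrightarrow> lp_norm a u \<le> c"
  shows "discrepancy TYPE('m) a b \<le> c"
  using discrepancy_attained[OF assms(1,2), where 'm = 'm] assms(3) by metis

text \<open>A coordinate vector has norm 1 for every exponent. This also makes the discrepancy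
  positive, so that it may be divided by.\<close>

lemma discrepancy_ge_1:
  assumes "1 \<le> a" "1 \<le> b"
  shows "1 \<le> discrepancy TYPE('m::finite) a b"
  using lp_norm_le_discrepancy[OF assms, of "axis undefined 1 :: real ^ 'm"]
  by (simp add: lp_norm_axis assms)

lemma worst_case_upper_bound:
  fixes z :: "real ^ 'm" and \<beta> :: "real ^ 'n"
  assumes "0 \<le> \<rho>" "1 \<le> p" "1 \<le> q"
  shows "worst_case \<rho> p q z \<beta>
    \<le> lp_norm p z + \<rho> * discrepancy TYPE('m) p q * lp_norm (conj_exponent q) \<beta>"
proof -
  obtain u where u: "lp_norm q u \<le> \<rho> * lp_norm (conj_exponent q) \<beta>"
    "worst_case \<rho> p q z \<beta> = lp_norm p (z + u)"
    by (rule worst_case_witness[OF assms])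
  have "lp_norm p (z + u) \<le> lp_norm p z + lp_norm p u" by (rule lp_norm_triangle[OF assms(2)])
  also have "lp_norm p u \<le> discrepancy TYPE('m) p q * lp_norm q u"
    by (rule lp_norm_le_discrepancy[OF assms(2,3)])
  also have "\<dots> \<le> discrepancy TYPE('m) p q * (\<rho> * lp_norm (conj_exponent q) \<beta>)"
    using u(1) discrepancy_ge_1[OF assms(2,3), where 'm = 'm] by (intro mult_left_mono) auto
  finally show ?thesis using u(2) by (simp add: mult_ac)
qed

lemma worst_case_1:
  fixes z :: "real ^ 'm" and \<beta> :: "real ^ 'n"
  assumes "0 \<le> \<rho>" "1 \<le> q"
  shows "lp_norm 1 z + \<rho> * discrepancy TYPE('m) 1 q * lp_norm (conj_exponent q) \<beta>
    \<le> worst_case \<rho> 1 q z \<beta>"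
proof -
  define r where "r = \<rho> * lp_norm (conj_exponent q) \<beta>"
  have r: "0 \<le> r"
    using assms lp_norm_nonneg[OF conj_exponent(1)[OF assms(2)], of \<beta>] by (simp add: r_def)
  obtain u :: "real ^ 'm" where u: "lp_norm q u = 1" "lp_norm 1 u = discrepancy TYPE('m) 1 q"
    using discrepancy_attained[of 1 q, where 'm = 'm] assms by auto
  \<comment> \<open>The moduli come from the maximizer scaled by \<open>r\<close> and the signs from
    \<open>z\<close>. The \<open>q\<close>-norm sees only moduli, while in the 1-norm of z + w
    nothing cancels.\<close>
  define w :: "real ^ 'm" where "w = (\<chi> i. if z $ i < 0 then - (r * \<bar>u $ i\<bar>) else r * \<bar>u $ i\<bar>)"
  have "lp_norm q w = lp_norm q (r *\<^sub>R u)"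
    unfolding lp_norm_def by (rule lp_fam_abs_cong) (auto simp: w_def assms abs_mult)
  then have "lp_norm q w \<le> r" using r u by (simp add: lp_norm_scaleR assms)
  then have "lp_norm 1 (z + w) \<le> worst_case \<rho> 1 q z \<beta>"
    by (intro worst_case_ge) (auto simp: assms r_def)
  moreover have "\<bar>z $ i + w $ i\<bar> = \<bar>z $ i\<bar> + r * \<bar>u $ i\<bar>" for i
    using mult_nonneg_nonneg[OF r, of "\<bar>u $ i\<bar>"] by (auto simp: w_def)
  then have "lp_norm 1 (z + w) = lp_norm 1 z + r * lp_norm 1 u"
    by (simp add: lp_norm_def lp_fam_1 sum.distrib sum_distrib_left)
  ultimately show ?thesis by (simp add: u r_def mult_ac)
qed

lemma worst_case_top:
  fixes z :: "real ^ 'm" and \<beta> :: "real ^ 'n"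
  assumes "0 \<le> \<rho>" "1 \<le> q"
  shows "lp_norm top z + \<rho> * discrepancy TYPE('m) top q * lp_norm (conj_exponent q) \<beta>
    \<le> worst_case \<rho> top q z \<beta>"
proof -
  define r where "r = \<rho> * lp_norm (conj_exponent q) \<beta>"
  have r: "0 \<le> r"
    using assms lp_norm_nonneg[OF conj_exponent(1)[OF assms(2)], of \<beta>] by (simp add: r_def)
  \<comment> \<open>Every entry is bounded by the \<open>q\<close>-norm, so it suffices to gain
    \<open>r\<close> in the maximum norm.\<close>
  have "discrepancy TYPE('m) top q \<le> 1"
  proof (rule discrepancy_leI)
    fix u :: "real ^ 'm" assume "lp_norm q u = 1"
    then show "lp_norm top u \<le> 1"
      using abs_le_lp_fam[OF assms(2), of "($) u"] by (simp add: lp_norm_def lp_fam_top_le_iff)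
  qed (use assms in auto)
  then have d: "r * discrepancy TYPE('m) top q \<le> r" using r mult_left_le by blast
  have "lp_norm top z \<in> range (\<lambda>i. \<bar>z $ i\<bar>)"
    unfolding lp_norm_def lp_fam_top by (rule Max_in) auto
  then obtain k where k: "lp_norm top z = \<bar>z $ k\<bar>" by auto
  \<comment> \<open>The whole radius is spent on a coordinate where \<open>z\<close> has its largest
    modulus, with matching sign.\<close>
  define w :: "real ^ 'm" where "w = (if z $ k < 0 then - r else r) *\<^sub>R axis k 1"
  have "lp_norm q w \<le> r" using r by (simp add: w_def lp_norm_scaleR lp_norm_axis assms)
  then have "lp_norm top (z + w) \<le> worst_case \<rho> top q z \<beta>"
    by (intro worst_case_ge) (auto simp: assms r_def)
  moreover have "\<bar>(z + w) $ k\<bar> = lp_norm top z + r"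
    using r by (auto simp: w_def k)
  moreover have "\<bar>(z + w) $ k\<bar> \<le> lp_norm top (z + w)"
    unfolding lp_norm_def by (rule abs_le_lp_fam) simp
  ultimately show ?thesis using d by (simp add: r_def mult_ac)
qed

lemma worst_case_lower_bound:
  fixes z :: "real ^ 'm" and \<beta> :: "real ^ 'n"
  assumes "0 \<le> \<rho>" "1 \<le> p" "1 \<le> q"
  shows "lp_norm p z + \<rho> / discrepancy TYPE('m) q p * lp_norm (conj_exponent q) \<beta>
    \<le> worst_case \<rho> p q z \<beta>"
proof -
  define r where "r = \<rho> * lp_norm (conj_exponent q) \<beta>"
  have r: "0 \<le> r"
    using assms lp_norm_nonneg[OF conj_exponent(1)[OF assms(3)], of \<beta>] by (simp add: r_def)
  let ?d = "discrepancy TYPE('m) q p"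
  have d: "1 \<le> ?d" using assms by (intro discrepancy_ge_1)
  \<comment> \<open>A nonzero direction \<open>x\<close> is needed even for z = 0; then any
    coordinate vector with factor 0 does.\<close>
  obtain x :: "real ^ 'm" and t where x: "x \<noteq> 0" "z = t *\<^sub>R x" "0 \<le> t"
  proof (cases "z = 0")
    case True
    then show ?thesis using that[of "axis undefined 1" 0] by (simp add: axis_eq_0_iff)
  next
    case False
    then show ?thesis using that[of z 1] by simp
  qed
  have pos: "0 < lp_norm p x" "0 < lp_norm q x" using x assms by (auto simp: lp_norm_pos_iff)
  \<comment> \<open>This is the multiple of \<open>x\<close> whose \<open>q\<close>-norm is exactly
    \<open>r\<close>.\<close>
  let ?s = "r / lp_norm q x"
  have "lp_norm q (?s *\<^sub>R x) \<le> r" using pos r by (simp add: lp_norm_scaleR assms)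
  then have "lp_norm p (z + ?s *\<^sub>R x) \<le> worst_case \<rho> p q z \<beta>"
    by (intro worst_case_ge) (auto simp: assms r_def)
  moreover have "lp_norm p (z + ?s *\<^sub>R x) = lp_norm p z + ?s * lp_norm p x"
    using x pos r unfolding x(2) scaleR_add_left[symmetric]
    by (simp add: lp_norm_scaleR assms distrib_right)
  moreover have "r / ?d \<le> ?s * lp_norm p x"
    using lp_norm_le_discrepancy[OF assms(3,2), of x] pos d r
      mult_left_mono[of "lp_norm q x" "?d * lp_norm p x" r] by (simp add: field_simps)
  ultimately show ?thesis by (simp add: r_def mult_ac)
qed

subsection \<open>Equality in the upper bound and gap in the lower bound\<close>

text \<open>Summing the tangent inequality at \<open>c\<close> over all coordinates leaves a
  positive multiple of the sum of y i - c, which must be nonpositive.\<close>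

lemma power_mean_sum:
  fixes y :: "'i::finite \<Rightarrow> real"
  assumes "1 \<le> s" "0 < c" "\<And>i. 0 \<le> y i" "(\<Sum>i\<in>UNIV. y i powr s) \<le> real CARD('i) * c powr s"
  shows "(\<Sum>i\<in>UNIV. y i) \<le> real CARD('i) * c"
proof -
  have "(\<Sum>i\<in>(UNIV :: 'i set). c powr s + s * c powr (s - 1) * (y i - c)) \<le> (\<Sum>i\<in>UNIV. y i powr s)"
    using assms by (intro sum_mono powr_above_tangent)
  then have "s * c powr (s - 1) * (\<Sum>i\<in>UNIV. y i - c) \<le> 0"
    using assms(4) by (simp add: sum.distrib flip: sum_distrib_left)
  then have "(\<Sum>i\<in>UNIV. y i - c) \<le> 0"
    using assms by (simp add: mult_le_0_iff)
  then show ?thesis by (simp add: sum_subtractf)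
qed

text \<open>Equality case of the power mean inequality: one coordinate different from
  \<open>c\<close> makes its tangent inequality, hence the summed one, strict.\<close>

lemma power_mean_sum_eq:
  fixes y :: "'i::finite \<Rightarrow> real"
  assumes "1 < s" "0 < c" "\<And>i. 0 \<le> y i" "(\<Sum>i\<in>UNIV. y i powr s) = real CARD('i) * c powr s"
    and "real CARD('i) * c \<le> (\<Sum>i\<in>UNIV. y i)"
  shows "y k = c"
proof (rule ccontr)
  assume k: "y k \<noteq> c"
  have "(\<Sum>i\<in>(UNIV :: 'i set). c powr s + s * c powr (s - 1) * (y i - c)) < (\<Sum>i\<in>UNIV. y i powr s)"
    using assms k powr_above_tangent_strict[of s c "y k"]
    by (intro sum_strict_mono_ex1 ballI powr_above_tangent) auto
  then have "s * c powr (s - 1) * (\<Sum>i\<in>UNIV. y i - c) < 0"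
    using assms(4) by (simp add: sum.distrib flip: sum_distrib_left)
  then have "(\<Sum>i\<in>UNIV. y i - c) < 0"
    using assms by (simp add: mult_less_0_iff)
  then show False using assms(5) by (simp add: sum_subtractf)
qed

lemma lp_fam_power_mean:
  fixes f :: "'i::finite \<Rightarrow> real"
  assumes "1 \<le> a" "a \<le> b"
  shows "lp_fam (ennreal a) f \<le> real CARD('i) powr (1 / a - 1 / b) * lp_fam (ennreal b) f"
proof (cases "lp_fam (ennreal b) f = 0")
  case True
  then have "f = (\<lambda>i. 0)" using assms lp_fam_eq_0_iff[of "ennreal b" f] by auto
  then show ?thesis by (simp add: lp_fam_zero)
next
  case False
  define N B where "N = real CARD('i)" and "B = lp_fam (ennreal b) f"
  have N: "0 < N" by (simp add: N_def)
  have B: "0 < B" using False lp_fam_nonneg[of "ennreal b" f] assms by (simp add: B_def)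
  \<comment> \<open>The constant family with value c^(1/a) has the same \<open>b\<close>-norm B as
    \<open>f\<close>; the power mean inequality is used for |f i|^a with exponent b / a.\<close>
  define c where "c = (B * N powr (- 1 / b)) powr a"
  have "N * c powr (b / a) = N * (B powr b * N powr (- 1))"
    using assms N B by (simp add: c_def powr_powr powr_mult)
  also have "\<dots> = B powr b" using N by (simp add: powr_minus)
  also have "\<dots> = (\<Sum>i\<in>UNIV. (\<bar>f i\<bar> powr a) powr (b / a))"
    using assms by (simp add: B_def lp_fam_powr powr_powr)
  finally have E: "N * c powr (b / a) = (\<Sum>i\<in>UNIV. (\<bar>f i\<bar> powr a) powr (b / a))" .
  have "(\<Sum>i\<in>UNIV. \<bar>f i\<bar> powr a) \<le> N * c"
    unfolding N_def
  proof (rule power_mean_sum)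
    show "1 \<le> b / a" using assms by simp
    show "0 < c" using N B by (simp add: c_def)
    show "(\<Sum>i\<in>UNIV. (\<bar>f i\<bar> powr a) powr (b / a)) \<le> real CARD('i) * c powr (b / a)"
      using E by (simp only: N_def order_refl)
  qed simp
  also have "N * c = N powr (1 - a / b) * B powr a"
    using N B by (simp add: c_def powr_mult powr_powr powr_divide powr_diff powr_minus_divide)
  also have "1 - a / b = (1 / a - 1 / b) * a" using assms by (simp add: left_diff_distrib)
  also have "N powr ((1 / a - 1 / b) * a) * B powr a = (N powr (1 / a - 1 / b) * B) powr a"
    using N B by (simp add: powr_mult powr_powr)
  finally show ?thesis
    using assms B by (subst lp_fam_le_iff) (auto simp: B_def N_def)
qed

text \<open>All entries have modulus at most 1, so their powers decrease as the exponent grows. The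
  unit sphere suffices because it is what \<open>discrepancy_leI\<close> asks for.\<close>

lemma lp_norm_antimono_exponent:
  assumes "1 \<le> p" "p \<le> q" "lp_norm p u = 1"
  shows "lp_norm q u \<le> 1"
proof -
  have u: "\<bar>u $ i\<bar> \<le> 1" for i
    using abs_le_lp_fam[OF assms(1), of "($) u"] assms(3) by (simp add: lp_norm_def)
  have "1 \<le> q" using assms by simp
  then show ?thesis
  proof (cases q rule: exponent_cases)
    case 1
    then show ?thesis using u by (simp add: lp_norm_def lp_fam_top_le_iff)
  next
    case (2 b)
    with assms(1,2) obtain a where a: "p = ennreal a" "1 \<le> a" "a \<le> b"
      by (cases p rule: exponent_cases) (auto simp: top_unique)
    have "(\<Sum>i\<in>UNIV. \<bar>u $ i\<bar> powr b) \<le> (\<Sum>i\<in>UNIV. \<bar>u $ i\<bar> powr a)"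
      using u a by (intro sum_mono powr_mono') auto
    also have "\<dots> = 1" using a assms(3) lp_fam_powr[of a "($) u"] by (simp add: lp_norm_def)
    finally show ?thesis using 2 by (simp add: lp_norm_def lp_fam_le_iff)
  qed
qed

lemma finite_vec_components_in:
  assumes "finite F"
  shows "finite {u :: 'a ^ 'm. \<forall>i. u $ i \<in> F}"
proof (rule finite_subset)
  show "{u :: 'a ^ 'm. \<forall>i. u $ i \<in> F} \<subseteq> vec_lambda ` (UNIV \<rightarrow>\<^sub>E F)"
    by (auto intro!: image_eqI[of _ _ "($) _"])
  show "finite (vec_lambda ` (UNIV \<rightarrow>\<^sub>E F) :: ('a ^ 'm) set)"
    using assms by (intro finite_imageI finite_PiE) auto
qed

text \<open>Maximality forces equality in a coordinatewise or power mean inequality, which confines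
  every entry to a finite set: 1 and -1 for q = infinity; -1, 0 and 1 for q < p; and plus or minus
  N^(-1/b) for p < q = b finite.\<close>

lemma finite_discrepancy_maximizers:
  assumes "1 < p" "p < top" "1 \<le> q" "p \<noteq> q"
  shows "finite {u :: real ^ 'm. lp_norm q u = 1 \<and> lp_norm p u = discrepancy TYPE('m) p q}"
proof -
  let ?N = "real CARD('m)"
  let ?M = "{u :: real ^ 'm. lp_norm q u = 1 \<and> lp_norm p u = discrepancy TYPE('m) p q}"
  obtain a where a: "p = ennreal a" "1 < a" using assms by (cases p) auto
  have p: "1 \<le> p" using assms by simp
  have d: "1 \<le> discrepancy TYPE('m) p q" using p assms(3) by (rule discrepancy_ge_1)
  \<comment> \<open>A maximizer is compared with a constant vector in the unit ball; this is used
    with c = 1 for q = infinity and with c = N^(-1/b) for p < q finite.\<close>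
  have ge: "c powr a * ?N \<le> (\<Sum>i\<in>UNIV. \<bar>u $ i\<bar> powr a)"
    if "u \<in> ?M" "0 \<le> c" "lp_norm q (\<chi> i. c :: real ^ 'm) \<le> 1" for u c
  proof -
    have "(\<Sum>i\<in>(UNIV :: 'm set). c powr a) = lp_norm p (\<chi> i. c :: real ^ 'm) powr a"
      using that(2) a lp_fam_powr[of a "\<lambda>i :: 'm. c"] by (simp add: lp_norm_def)
    also have "lp_norm p (\<chi> i. c :: real ^ 'm) \<le> lp_norm p u"
      using order_trans[OF lp_norm_le_discrepancy[OF p assms(3)] mult_left_le[OF that(3)]] that(1) d
      by auto
    then have "lp_norm p (\<chi> i. c :: real ^ 'm) powr a \<le> lp_norm p u powr a"
      using a p by (intro powr_mono2 lp_norm_nonneg) auto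
    also have "lp_norm p u powr a = (\<Sum>i\<in>UNIV. \<bar>u $ i\<bar> powr a)"
      using a lp_fam_powr[of a "($) u"] by (simp add: lp_norm_def)
    finally show ?thesis by (simp add: mult.commute)
  qed
  have "\<exists>F. finite F \<and> (\<forall>u\<in>?M. \<forall>i. u $ i \<in> F)"
    using assms(3)
  proof (cases q rule: exponent_cases)
    case 1
    have "u $ i \<in> {-1, 1}" if u: "u \<in> ?M" for u i
    proof -
      have le: "\<bar>u $ j\<bar> \<le> 1" for j
        using abs_le_lp_fam[of q "($) u" j] u assms(3) by (simp add: lp_norm_def)
      have "lp_norm q (\<chi> i. 1 :: real ^ 'm) \<le> 1"
        by (simp add: 1 lp_norm_def lp_fam_top_le_iff)
      then have "(\<Sum>j\<in>(UNIV :: 'm set). 1) \<le> (\<Sum>j\<in>UNIV. \<bar>u $ j\<bar> powr a)"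
        using ge[OF u, of 1] by simp
      moreover have le': "\<bar>u $ j\<bar> powr a \<le> 1" for j
        using le a powr_mono2[of a "\<bar>u $ j\<bar>" 1] by simp
      then have "(\<Sum>j\<in>UNIV. \<bar>u $ j\<bar> powr a) \<le> (\<Sum>j\<in>(UNIV :: 'm set). 1)"
        by (intro sum_mono) auto
      ultimately have "\<bar>u $ i\<bar> powr a = 1"
        using sum_mono_inv[of "\<lambda>j. \<bar>u $ j\<bar> powr a" UNIV "\<lambda>j. 1" i] le' by (metis UNIV_I antisym finite)
      then have "(\<bar>u $ i\<bar> powr a) powr (1 / a) = 1" by simp
      then show ?thesis using a by (auto simp: powr_powr abs_if split: if_splits)
    qed
    then show ?thesis by (intro exI[of _ "{-1, 1}"]) blast
  next
    case (2 b)
    have sb: "(\<Sum>i\<in>UNIV. \<bar>u $ i\<bar> powr b) = 1" if "u \<in> ?M" for u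
      using that 2 lp_fam_powr[of b "($) u"] by (simp add: lp_norm_def)
    show ?thesis
    proof (cases "b < a")
      case True
      have "u $ i \<in> {-1, 0, 1}" if u: "u \<in> ?M" for u i
      proof -
        have le: "\<bar>u $ j\<bar> \<le> 1" for j
          using abs_le_lp_fam[of q "($) u" j] u assms(3) by (simp add: lp_norm_def)
        then have le': "\<bar>u $ j\<bar> powr a \<le> \<bar>u $ j\<bar> powr b" for j
          using True by (intro powr_mono') auto
        \<comment> \<open>The maximum is at least 1, so the sum of \<open>a\<close>-th powers cannot
          be below the sum of \<open>b\<close>-th powers. Equality then holds in each coordinate,
          which only moduli 0 and 1 allow.\<close>
        have "1 powr a \<le> lp_norm p u powr a"
          using u d a by (intro powr_mono2) auto
        also have "\<dots> = (\<Sum>j\<in>UNIV. \<bar>u $ j\<bar> powr a)"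
          using a lp_fam_powr[of a "($) u"] by (simp add: lp_norm_def)
        finally have "(\<Sum>j\<in>UNIV. \<bar>u $ j\<bar> powr a) = (\<Sum>j\<in>UNIV. \<bar>u $ j\<bar> powr b)"
          using sb[OF u] sum_mono[of UNIV "\<lambda>j. \<bar>u $ j\<bar> powr a" "\<lambda>j. \<bar>u $ j\<bar> powr b"] le' by simp
        then have e: "\<bar>u $ i\<bar> powr a = \<bar>u $ i\<bar> powr b"
          using sum_mono_inv[of "\<lambda>j. \<bar>u $ j\<bar> powr a" UNIV "\<lambda>j. \<bar>u $ j\<bar> powr b" i] le' by simp
        have "\<bar>u $ i\<bar> = 1" if "u $ i \<noteq> 0"
        proof (rule ccontr)
          assume "\<bar>u $ i\<bar> \<noteq> 1"
          then have "\<bar>u $ i\<bar> powr a < \<bar>u $ i\<bar> powr b"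
            using that le[of i] True by (intro powr_less_mono') auto
          with e show False by simp
        qed
        then show ?thesis by (cases "u $ i = 0") (auto simp: abs_if split: if_splits)
      qed
      then show ?thesis by (intro exI[of _ "{-1, 0, 1}"]) blast
    next
      case False
      then have ab: "a < b" using assms(4) a 2 by auto
      define c where "c = ?N powr (- 1 / b)"
      have N: "0 < ?N" by simp
      have "c powr b = ?N powr (- 1)" unfolding c_def powr_powr using a ab by simp
      then have c: "0 < c" "?N * c powr b = 1"
        using N by (auto simp: c_def powr_minus)
      have "u $ i \<in> {-c, c}" if u: "u \<in> ?M" for u i
      proof -
        have "lp_norm q (\<chi> i. c :: real ^ 'm) \<le> 1"
          using 2 c by (simp add: lp_norm_def lp_fam_le_iff)
        then have *: "?N * c powr a \<le> (\<Sum>j\<in>UNIV. \<bar>u $ j\<bar> powr a)"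
          using ge[OF u, of c] c by (simp add: mult.commute)
        \<comment> \<open>Equality in the power mean inequality for |u_j|^a with exponent b / a: the
          \<open>b\<close>-th powers sum to N c^b = 1, and the \<open>a\<close>-th powers to at
          least N c^a.\<close>
        have "\<bar>u $ i\<bar> powr a = c powr a"
          by (rule power_mean_sum_eq[of "b / a"])
            (use * a ab c sb[OF u] in \<open>auto simp: powr_powr\<close>)
        then have "(\<bar>u $ i\<bar> powr a) powr (1 / a) = (c powr a) powr (1 / a)" by simp
        then show ?thesis using a c by (auto simp: powr_powr abs_if split: if_splits)
      qed
      then show ?thesis by (intro exI[of _ "{-c, c}"]) blast
    qed
  qed
  then obtain F where "finite F" "?M \<subseteq> {u. \<forall>i. u $ i \<in> F}" by auto
  then show ?thesis using finite_vec_components_in finite_subset by blast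
qed

section \<open>The equality set of the upper bound\<close>

text \<open>Equality in (UB) forces equality at every link of its proof: \<open>u\<close> lies on
  the sphere of radius \<open>r\<close>, is a maximizer up to scaling, and satisfies the triangle
  equality with \<open>z\<close>. Conversely, a multiple of a maximizer can be lengthened along its
  own line.\<close>

lemma worst_case_eq_upper_bound_iff:
  fixes z :: "real ^ 'm" and \<beta> :: "real ^ 'n"
  assumes "0 < \<rho>" "1 < p" "p < top" "1 \<le> q" "\<beta> \<noteq> 0"
  shows "worst_case \<rho> p q z \<beta>
      = lp_norm p z + \<rho> * discrepancy TYPE('m) p q * lp_norm (conj_exponent q) \<beta>
    \<longleftrightarrow> (\<exists>u :: real ^ 'm. lp_norm q u = 1 \<and> lp_norm p u = discrepancy TYPE('m) p q \<and> z \<in> span {u})"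
    (is "?L \<longleftrightarrow> ?R")
proof -
  obtain a where a: "p = ennreal a" "1 < a" using assms by (cases p) auto
  have p: "1 \<le> p" using assms by simp
  let ?d = "discrepancy TYPE('m) p q"
  have d: "1 \<le> ?d" using p assms(4) by (rule discrepancy_ge_1)
  define r where "r = \<rho> * lp_norm (conj_exponent q) \<beta>"
  have r: "0 < r"
    using assms lp_norm_pos_iff[OF conj_exponent(1)[OF assms(4)], of \<beta>] by (simp add: r_def)
  show ?thesis
  proof
    assume ?L
    obtain u where u: "lp_norm q u \<le> r" "worst_case \<rho> p q z \<beta> = lp_norm p (z + u)"
      using worst_case_witness[OF less_imp_le[OF assms(1)] p assms(4)] unfolding r_def .
    have eq: "lp_norm p (z + u) = lp_norm p z + ?d * r"
      using \<open>?L\<close> u by (simp add: r_def mult_ac)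
    have le: "lp_norm p u \<le> ?d * lp_norm q u" by (rule lp_norm_le_discrepancy[OF p assms(4)])
    have le': "?d * lp_norm q u \<le> ?d * r" using u d by (intro mult_left_mono) auto
    have tri: "lp_norm p (z + u) \<le> lp_norm p z + lp_norm p u" by (rule lp_norm_triangle[OF p])
    have "?d * lp_norm q u = ?d * r" using le le' tri eq by linarith
    then have qu: "lp_norm q u = r" using d by simp
    have pu: "lp_norm p u = ?d * r" using le le' tri eq by linarith
    have "u \<noteq> 0" using qu r lp_norm_pos_iff[OF assms(4), of u] by simp
    then obtain c where c: "z = c *\<^sub>R u"
      using lp_norm_triangle_eq[OF a(2), of u z] a eq pu by auto
    let ?v = "(1 / r) *\<^sub>R u"
    have "lp_norm q ?v = 1" "lp_norm p ?v = ?d"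
      using r qu pu p assms(4) by (simp_all add: lp_norm_scaleR)
    moreover have "z = (c * r) *\<^sub>R ?v" using r c by simp
    then have "z \<in> span {?v}" unfolding span_singleton by blast
    ultimately show ?R by blast
  next
    assume ?R
    then obtain u k where u: "lp_norm q u = 1" "lp_norm p u = ?d" "z = k *\<^sub>R u"
      by (auto simp: span_singleton)
    \<comment> \<open>The sign makes |k + s| = |k| + r.\<close>
    let ?s = "if k < 0 then - r else r"
    have "lp_norm q (?s *\<^sub>R u) \<le> r" using r u assms(4) by (simp add: lp_norm_scaleR)
    then have "lp_norm p (z + ?s *\<^sub>R u) \<le> worst_case \<rho> p q z \<beta>"
      using assms p by (intro worst_case_ge) (auto simp: r_def)
    moreover have "lp_norm p (z + ?s *\<^sub>R u) = \<bar>k + ?s\<bar> * ?d"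
      unfolding u(3) scaleR_add_left[symmetric] by (simp only: lp_norm_scaleR[OF p] u(2))
    moreover have "\<bar>k + ?s\<bar> * ?d = lp_norm p z + r * ?d"
      using r p u by (simp add: lp_norm_scaleR algebra_simps)
    ultimately show ?L
      using worst_case_upper_bound[of \<rho> p q z \<beta>] assms p by (simp add: r_def mult_ac)
  qed
qed

lemma worst_case_tight_set:
  fixes \<beta> :: "real ^ 'n"
  assumes "0 < \<rho>" "1 < p" "p < top" "1 \<le> q" "p \<noteq> q" "\<beta> \<noteq> 0"
  shows "\<exists>\<V> :: (real ^ 'm) set set. finite \<V> \<and> (\<forall>V\<in>\<V>. subspace V \<and> dim V = 1) \<and>
    {z :: real ^ 'm. worst_case \<rho> p q z \<beta>
      = lp_norm p z + \<rho> * discrepancy TYPE('m) p q * lp_norm (conj_exponent q) \<beta>} = \<Union>\<V>"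
proof -
  let ?M = "{u :: real ^ 'm. lp_norm q u = 1 \<and> lp_norm p u = discrepancy TYPE('m) p q}"
  have "finite ((\<lambda>u. span {u}) ` ?M)"
    by (intro finite_imageI finite_discrepancy_maximizers[OF assms(2-5)])
  moreover have "\<forall>V\<in>(\<lambda>u. span {u}) ` ?M. subspace V \<and> dim V = 1"
    \<comment> \<open>Norm 1 excludes the zero vector, so each span is a genuine line.\<close>
    using lp_norm_eq_0_iff[OF assms(4), of "0 :: real ^ 'm"] by (auto simp: dim_singleton)
  moreover have "{z :: real ^ 'm. worst_case \<rho> p q z \<beta>
      = lp_norm p z + \<rho> * discrepancy TYPE('m) p q * lp_norm (conj_exponent q) \<beta>}
    = \<Union> ((\<lambda>u. span {u}) ` ?M)"
    using worst_case_eq_upper_bound_iff[OF assms(1-4,6), where 'm = 'm] by auto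
  ultimately show ?thesis by blast
qed

lemma worst_case_AE_strict:
  fixes \<beta> :: "real ^ 'n"
  assumes "0 < \<rho>" "1 < p" "p < top" "1 \<le> q" "p \<noteq> q" "\<beta> \<noteq> 0" "2 \<le> CARD('m::finite)"
  shows "AE z :: real ^ 'm in lebesgue. worst_case \<rho> p q z \<beta>
    < lp_norm p z + \<rho> * discrepancy TYPE('m) p q * lp_norm (conj_exponent q) \<beta>"
proof -
  let ?E = "{z :: real ^ 'm. worst_case \<rho> p q z \<beta>
      = lp_norm p z + \<rho> * discrepancy TYPE('m) p q * lp_norm (conj_exponent q) \<beta>}"
  obtain \<V> :: "(real ^ 'm) set set"
    where V: "finite \<V>" "\<And>V. V \<in> \<V> \<Longrightarrow> subspace V \<and> dim V = 1" "?E = \<Union>\<V>"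
    using worst_case_tight_set[OF assms(1-6), where 'm = 'm] by blast
  \<comment> \<open>Here the dimension enters: lines are null sets once the ambient dimension is at
    least 2.\<close>
  have "negligible (\<Union>\<V>)"
    using V assms(7) by (intro negligible_Union negligible_lowdim) auto
  then have "?E \<in> null_sets lebesgue" unfolding V(3) negligible_iff_null_sets .
  then show ?thesis
  proof (rule AE_I')
    have "worst_case \<rho> p q z \<beta>
      \<le> lp_norm p z + \<rho> * discrepancy TYPE('m) p q * lp_norm (conj_exponent q) \<beta>" for z :: "real ^ 'm"
      using assms by (intro worst_case_upper_bound) auto
    then show "{z \<in> space lebesgue. \<not> worst_case \<rho> p q z \<beta>
        < lp_norm p z + \<rho> * discrepancy TYPE('m) p q * lp_norm (conj_exponent q) \<beta>} \<subseteq> ?E"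
      by (auto simp: not_less intro: antisym)
  qed
qed

section \<open>The gap in the lower bound tends to zero\<close>

lemma INF_eq_0I:
  fixes f :: "'a \<Rightarrow> real" and h :: "real \<Rightarrow> real"
  assumes "\<And>x. 0 \<le> f x" "\<And>t. 0 < t \<Longrightarrow> f (g t) \<le> h t" "(h \<longlongrightarrow> 0) at_top"
  shows "(INF x. f x) = 0"
proof (rule antisym)
  have b: "bdd_below (range f)" using assms(1) by (auto intro!: bdd_belowI[of _ 0])
  have "(INF x. f x) \<le> h t" if "0 < t" for t
    using cINF_lower[OF b, of "g t"] assms(2)[OF that] by simp
  then show "(INF x. f x) \<le> 0"
    by (intro tendsto_lowerbound[OF assms(3)]) (auto intro: eventually_mono[OF eventually_gt_at_top[of 0]])
  show "0 \<le> (INF x. f x)" using assms(1) by (intro cINF_greatest) auto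
qed

text \<open>Tangent inequality at T. It converts a bound T^a + a T^(a-1) X on a sum of powers into
  the bound T + X on the norm.\<close>

lemma le_powr_add_linear:
  fixes T X a :: real
  assumes "1 \<le> a" "0 < T" "0 \<le> X"
  shows "T powr a + a * T powr (a - 1) * X \<le> (T + X) powr a"
  using powr_above_tangent[OF assms(1,2), of "T + X"] assms(2,3) by simp

text \<open>Coordinate \<open>k\<close> of z + u is at most t + r in modulus and the others at most
  \<open>r\<close>, so the sum of powers is at most (t + r)^a + N r^a. The bound X on the gap is
  chosen so that N r^a = a (t + r)^(a-1) X.\<close>

lemma worst_case_gap_axis:
  fixes \<beta> :: "real ^ 'n"
  assumes "0 \<le> \<rho>" "1 \<le> a" "ennreal a \<le> q" "0 < t"
    and r_def: "r = \<rho> * lp_norm (conj_exponent q) \<beta>"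
  shows "worst_case \<rho> (ennreal a) q (t *\<^sub>R axis k 1 :: real ^ 'm) \<beta>
      - lp_norm (ennreal a) (t *\<^sub>R axis k 1 :: real ^ 'm)
      - \<rho> / discrepancy TYPE('m) q (ennreal a) * lp_norm (conj_exponent q) \<beta>
    \<le> real CARD('m) * r powr a / (a * (t + r) powr (a - 1))"
proof -
  let ?N = "real CARD('m)"
  let ?z = "t *\<^sub>R axis k 1 :: real ^ 'm"
  have p: "1 \<le> ennreal a" and q: "1 \<le> q" using assms by (auto intro: order_trans[of _ "ennreal a"])
  have r: "0 \<le> r"
    using assms lp_norm_nonneg[OF conj_exponent(1)[OF q], of \<beta>] by (simp add: r_def)
  let ?X = "?N * r powr a / (a * (t + r) powr (a - 1))"
  obtain u where u: "lp_norm q u \<le> r" "worst_case \<rho> (ennreal a) q ?z \<beta> = lp_norm (ennreal a) (?z + u)"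
    using worst_case_witness[OF assms(1) p q, of \<beta> ?z] unfolding r_def by blast
  have ui: "\<bar>u $ i\<bar> \<le> r" for i
    using abs_le_lp_fam[OF q, of "($) u" i] u(1) by (simp add: lp_norm_def)
  have "\<bar>(?z + u) $ i\<bar> powr a \<le> (if i = k then (t + r) powr a else 0) + r powr a" for i
  proof (cases "i = k")
    case True
    have "\<bar>(?z + u) $ i\<bar> powr a \<le> (t + r) powr a"
      using ui[of i] True assms by (intro powr_mono2) auto
    then show ?thesis using True by (simp add: add_increasing2)
  next
    case False
    then show ?thesis using ui[of i] assms by (auto simp: axis_def intro: powr_mono2)
  qed
  then have "(\<Sum>i\<in>UNIV. \<bar>(?z + u) $ i\<bar> powr a)
      \<le> (\<Sum>i\<in>UNIV. (if i = k then (t + r) powr a else 0) + r powr a)"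
    by (intro sum_mono)
  also have "\<dots> = (t + r) powr a + a * (t + r) powr (a - 1) * ?X"
    using assms r by (simp add: sum.distrib)
  also have "\<dots> \<le> (t + r + ?X) powr a"
    using assms r by (intro le_powr_add_linear) auto
  finally have "lp_norm (ennreal a) (?z + u) \<le> t + r + ?X"
    unfolding lp_norm_def using assms r by (subst lp_fam_le_iff) auto
  moreover have "lp_norm (ennreal a) ?z = t"
    using assms p by (simp add: lp_norm_scaleR lp_norm_axis)
  \<comment> \<open>For p <= q norms decrease with the exponent, so the discrepancy is at most 1 and
    the subtracted term is at least \<open>r\<close>.\<close>
  moreover have "r \<le> r / discrepancy TYPE('m) q (ennreal a)"
  proof -
    have "discrepancy TYPE('m) q (ennreal a) \<le> 1"
      by (intro discrepancy_leI[OF q p] lp_norm_antimono_exponent[OF p assms(3)])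
    then show ?thesis using discrepancy_ge_1[OF q p, where 'm = 'm] r by simp
  qed
  ultimately show ?thesis using u(2) by (simp add: r_def mult_ac)
qed

text \<open>To first order the norm grows by a multiple of the sum of |u_i|, which the power mean
  inequality bounds by U. The resulting increment X exceeds r N^(1/a - 1/b), itself at most the
  subtracted term, only by the factor ((t + r) / t)^(a-1).\<close>

lemma worst_case_gap_const:
  fixes \<beta> :: "real ^ 'n"
  assumes "0 \<le> \<rho>" "1 \<le> b" "b \<le> a" "0 < t"
    and r_def: "r = \<rho> * lp_norm (conj_exponent (ennreal b)) \<beta>"
  shows "worst_case \<rho> (ennreal a) (ennreal b) ((\<chi> i. t) :: real ^ 'm) \<beta>
      - lp_norm (ennreal a) ((\<chi> i. t) :: real ^ 'm)
      - \<rho> / discrepancy TYPE('m) (ennreal b) (ennreal a) * lp_norm (conj_exponent (ennreal b)) \<beta>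
    \<le> r * real CARD('m) powr (1 / a - 1 / b) * (((t + r) / t) powr (a - 1) - 1)"
proof -
  define N where "N = real CARD('m)"
  have N: "0 < N" by (simp add: N_def)
  let ?z = "(\<chi> i. t) :: real ^ 'm"
  let ?d = "discrepancy TYPE('m) (ennreal b) (ennreal a)"
  have p: "1 \<le> ennreal a" and q: "1 \<le> ennreal b" and a: "1 \<le> a" using assms by auto
  have r: "0 \<le> r"
    using assms lp_norm_nonneg[OF conj_exponent(1)[OF q], of \<beta>] by (simp add: r_def)
  obtain u where u: "lp_norm (ennreal b) u \<le> r"
    "worst_case \<rho> (ennreal a) (ennreal b) ?z \<beta> = lp_norm (ennreal a) (?z + u)"
    using worst_case_witness[OF assms(1) p q, of \<beta> ?z] unfolding r_def by blast
  have ui: "\<bar>u $ i\<bar> \<le> r" for i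
    using abs_le_lp_fam[OF q, of "($) u" i] u(1) by (simp add: lp_norm_def)
  define U where "U = N powr (1 - 1 / b) * r"
  have "(\<Sum>i\<in>UNIV. \<bar>u $ i\<bar>) \<le> N powr (1 - 1 / b) * lp_norm (ennreal b) u"
    using lp_fam_power_mean[of 1 b "($) u"] assms by (simp add: lp_norm_def lp_fam_1 N_def)
  also have "\<dots> \<le> U" unfolding U_def using u by (intro mult_left_mono) auto
  finally have U: "(\<Sum>i\<in>UNIV. \<bar>u $ i\<bar>) \<le> U" .
  have U0: "0 \<le> U" using r by (simp add: U_def)
  have "\<bar>(?z + u) $ i\<bar> powr a \<le> t powr a + a * (t + r) powr (a - 1) * \<bar>u $ i\<bar>" for i
  proof -
    have "\<bar>(?z + u) $ i\<bar> powr a \<le> (t + \<bar>u $ i\<bar>) powr a"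
      using assms a by (intro powr_mono2) auto
    \<comment> \<open>The tangent is taken at the larger point t + |u_i| and evaluated at
      \<open>t\<close>, which yields an upper bound.\<close>
    also have "\<dots> \<le> t powr a + a * (t + \<bar>u $ i\<bar>) powr (a - 1) * \<bar>u $ i\<bar>"
      using powr_above_tangent[of a "t + \<bar>u $ i\<bar>" t] assms a by (simp add: add_pos_nonneg)
    also have "\<dots> \<le> t powr a + a * (t + r) powr (a - 1) * \<bar>u $ i\<bar>"
      using assms a ui[of i] by (intro add_left_mono mult_right_mono mult_left_mono powr_mono2) auto
    finally show ?thesis .
  qed
  then have "(\<Sum>i\<in>UNIV. \<bar>(?z + u) $ i\<bar> powr a)
      \<le> (\<Sum>i\<in>(UNIV :: 'm set). t powr a + a * (t + r) powr (a - 1) * \<bar>u $ i\<bar>)"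
    by (intro sum_mono)
  also have "\<dots> = N * t powr a + a * (t + r) powr (a - 1) * (\<Sum>i\<in>UNIV. \<bar>u $ i\<bar>)"
    by (simp add: sum.distrib N_def flip: sum_distrib_left)
  also have "\<dots> \<le> N * t powr a + a * (t + r) powr (a - 1) * U"
    using U a by (intro add_left_mono mult_left_mono) auto
  \<comment> \<open>T is the norm of the constant vector, and X is chosen so that T^(a-1) X = (t +
    r)^(a-1) U.\<close>
  also have "\<dots> = T powr a + a * T powr (a - 1) * X"
    if "T = N powr (1 / a) * t" "X = (t + r) powr (a - 1) * U / T powr (a - 1)" for T X
    using that N assms a by (simp add: powr_mult powr_powr)
  also have "T powr a + a * T powr (a - 1) * X \<le> (T + X) powr a"
    if "T = N powr (1 / a) * t" "X = (t + r) powr (a - 1) * U / T powr (a - 1)" for T X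
    using that N assms a U0 by (intro le_powr_add_linear) auto
  finally have le: "(\<Sum>i\<in>UNIV. \<bar>(?z + u) $ i\<bar> powr a) \<le> (T + X) powr a"
    if "T = N powr (1 / a) * t" "X = (t + r) powr (a - 1) * U / T powr (a - 1)" for T X
    using that by blast
  define T X where "T = N powr (1 / a) * t" and "X = (t + r) powr (a - 1) * U / T powr (a - 1)"
  have TX: "0 < T" "0 \<le> X" using N assms U0 by (auto simp: T_def X_def)
  have "lp_norm (ennreal a) (?z + u) \<le> T + X"
    unfolding lp_norm_def using a TX le[OF T_def X_def] by (subst lp_fam_le_iff) auto
  moreover have "lp_norm (ennreal a) ?z = T"
    unfolding lp_norm_def using assms a N TX
    by (subst lp_fam_eq_iff) (auto simp: T_def powr_mult powr_powr N_def)
  moreover have "X = ((t + r) / t) powr (a - 1) * (r * N powr (1 / a - 1 / b))"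
  proof -
    have "X = ((t + r) / t) powr (a - 1) * (r * (N powr (1 - 1 / b) / (N powr (1 / a)) powr (a - 1)))"
      using assms r N by (simp add: X_def T_def U_def powr_mult powr_divide mult_ac)
    also have "N powr (1 - 1 / b) / (N powr (1 / a)) powr (a - 1) = N powr ((1 - 1 / b) - (1 / a) * (a - 1))"
      by (simp only: powr_powr powr_diff[of N "1 - 1 / b" "1 / a * (a - 1)"])
    also have "(1 - 1 / b) - (1 / a) * (a - 1) = 1 / a - 1 / b" using a by (simp add: field_simps)
    finally show ?thesis .
  qed
  \<comment> \<open>The power mean inequality bounds the discrepancy by N^(1/b - 1/a).\<close>
  moreover have "r * N powr (1 / a - 1 / b) \<le> r / ?d"
  proof -
    have d: "1 \<le> ?d" by (rule discrepancy_ge_1[OF q p])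
    have "?d \<le> N powr (1 / b - 1 / a)"
    proof (rule discrepancy_leI[OF q p])
      fix v :: "real ^ 'm" assume "lp_norm (ennreal a) v = 1"
      then show "lp_norm (ennreal b) v \<le> N powr (1 / b - 1 / a)"
        using lp_fam_power_mean[of b a "($) v"] assms by (simp add: lp_norm_def N_def)
    qed
    then have "N powr (1 / a - 1 / b) * ?d \<le> N powr (1 / a - 1 / b) * N powr (1 / b - 1 / a)"
      by (intro mult_left_mono) auto
    also have "\<dots> = 1" using N by (simp flip: powr_add)
    finally have "N powr (1 / a - 1 / b) \<le> 1 / ?d" using d by (simp add: field_simps)
    then show ?thesis using r mult_left_mono[of _ "1 / ?d" r] by fastforce
  qed
  moreover have "\<rho> / ?d * lp_norm (conj_exponent (ennreal b)) \<beta> = r / ?d" by (simp add: r_def)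
  moreover have "r * N powr (1 / a - 1 / b) * (((t + r) / t) powr (a - 1) - 1)
      = ((t + r) / t) powr (a - 1) * (r * N powr (1 / a - 1 / b)) - r * N powr (1 / a - 1 / b)"
    by (simp only: right_diff_distrib) (simp add: mult_ac)
  ultimately show ?thesis unfolding u(2) N_def[symmetric] by linarith
qed

lemma worst_case_gap_INF:
  fixes \<beta> :: "real ^ 'n"
  assumes "0 \<le> \<rho>" "1 < p" "p < top" "1 \<le> q"
  shows "(INF z :: real ^ 'm. worst_case \<rho> p q z \<beta> - lp_norm p z
    - \<rho> / discrepancy TYPE('m) q p * lp_norm (conj_exponent q) \<beta>) = 0"
proof -
  obtain a where a: "p = ennreal a" "1 < a" using assms by (cases p) auto
  define r where "r = \<rho> * lp_norm (conj_exponent q) \<beta>"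
  have nonneg: "0 \<le> worst_case \<rho> p q z \<beta> - lp_norm p z
      - \<rho> / discrepancy TYPE('m) q p * lp_norm (conj_exponent q) \<beta>" for z :: "real ^ 'm"
    using worst_case_lower_bound[of \<rho> p q z \<beta>] assms(1,4) less_imp_le[OF assms(2)] by simp
  have r: "0 \<le> r"
    using assms lp_norm_nonneg[OF conj_exponent(1)[OF assms(4)], of \<beta>] by (simp add: r_def)
  show ?thesis
  proof (cases "p \<le> q")
    case True
    show ?thesis
    proof (rule INF_eq_0I[OF nonneg])
      show "worst_case \<rho> p q (t *\<^sub>R axis undefined 1 :: real ^ 'm) \<beta>
          - lp_norm p (t *\<^sub>R axis undefined 1 :: real ^ 'm)
          - \<rho> / discrepancy TYPE('m) q p * lp_norm (conj_exponent q) \<beta>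
        \<le> real CARD('m) * r powr a / (a * (t + r) powr (a - 1))" if "0 < t" for t
        unfolding a(1)
        by (rule worst_case_gap_axis[OF assms(1) _ _ that r_def]) (use a True in auto)
      show "((\<lambda>t. real CARD('m) * r powr a / (a * (t + r) powr (a - 1))) \<longlongrightarrow> 0) at_top"
        \<comment> \<open>Since a > 1, the denominator grows without bound.\<close>
        using a(2) by real_asymp
    qed
  next
    case False
    from assms(4) this a obtain b where b: "q = ennreal b" "1 \<le> b" "b \<le> a"
      by (cases q rule: exponent_cases) (auto simp: not_le ennreal_less_iff)
    show ?thesis
    proof (rule INF_eq_0I[OF nonneg])
      show "worst_case \<rho> p q ((\<chi> i. t) :: real ^ 'm) \<beta> - lp_norm p ((\<chi> i. t) :: real ^ 'm)
          - \<rho> / discrepancy TYPE('m) q p * lp_norm (conj_exponent q) \<beta>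
        \<le> r * real CARD('m) powr (1 / a - 1 / b) * (((t + r) / t) powr (a - 1) - 1)"
        if "0 < t" for t
        unfolding a(1) b(1)
        by (rule worst_case_gap_const[OF assms(1) b(2,3) that r_def[unfolded b(1)]])
      show "((\<lambda>t. r * real CARD('m) powr (1 / a - 1 / b) * (((t + r) / t) powr (a - 1) - 1)) \<longlongrightarrow> 0) at_top"
        \<comment> \<open>The ratio (t + r) / t tends to 1.\<close>
        by real_asymp
    qed
  qed
qed

theorem theorem4:
  fixes \<rho> :: real and p q :: ennreal
  assumes "\<rho> > 0" and "1 \<le> p" and "1 \<le> q"
  shows
   "(\<forall>(z :: real ^ 'm) (\<beta> :: real ^ 'n).
       worst_case \<rho> p q z \<beta>
         \<le> lp_norm p z + \<rho> * discrepancy TYPE('m) p q * lp_norm (conj_exponent q) \<beta>)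
  \<and> (p \<in> {1, \<infinity>} \<longrightarrow>
      (\<forall>(z :: real ^ 'm) (\<beta> :: real ^ 'n).
         worst_case \<rho> p q z \<beta>
           = lp_norm p z + \<rho> * discrepancy TYPE('m) p q * lp_norm (conj_exponent q) \<beta>))
  \<and> (1 < p \<and> p < \<infinity> \<and> p \<noteq> q \<and> CARD('m) \<ge> 2 \<longrightarrow>
      (\<forall>\<beta> :: real ^ 'n. \<beta> \<noteq> 0 \<longrightarrow>
         (\<exists>\<V> :: (real ^ 'm) set set. finite \<V> \<and> (\<forall>V\<in>\<V>. subspace V \<and> dim V = 1) \<and>
            {z :: real ^ 'm. worst_case \<rho> p q z \<beta>
               = lp_norm p z + \<rho> * discrepancy TYPE('m) p q * lp_norm (conj_exponent q) \<beta>}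
            = \<Union>\<V>)
       \<and> (AE z :: real ^ 'm in lebesgue.
            worst_case \<rho> p q z \<beta>
              < lp_norm p z + \<rho> * discrepancy TYPE('m) p q * lp_norm (conj_exponent q) \<beta>)))
  \<and> (1 < p \<and> p < \<infinity> \<longrightarrow>
      (\<forall>(z :: real ^ 'm) (\<beta> :: real ^ 'n).
         lp_norm p z + \<rho> / discrepancy TYPE('m) q p * lp_norm (conj_exponent q) \<beta>
           \<le> worst_case \<rho> p q z \<beta>))
  \<and> (1 < p \<and> p < \<infinity> \<longrightarrow>
      (\<forall>\<beta> :: real ^ 'n.
         (INF z :: real ^ 'm. worst_case \<rho> p q z \<beta> - lp_norm p z
            - \<rho> / discrepancy TYPE('m) q p * lp_norm (conj_exponent q) \<beta>) = 0))"
proof (intro conjI allI impI)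
  have \<rho>: "0 \<le> \<rho>" using assms by simp
  show upper: "worst_case \<rho> p q z \<beta>
      \<le> lp_norm p z + \<rho> * discrepancy TYPE('m) p q * lp_norm (conj_exponent q) \<beta>"
    for z :: "real ^ 'm" and \<beta> :: "real ^ 'n"
    using worst_case_upper_bound[OF \<rho> assms(2,3)] .
  show "worst_case \<rho> p q z \<beta>
      = lp_norm p z + \<rho> * discrepancy TYPE('m) p q * lp_norm (conj_exponent q) \<beta>"
    if "p \<in> {1, \<infinity>}" for z :: "real ^ 'm" and \<beta> :: "real ^ 'n"
    using that upper[of z \<beta>] worst_case_1[OF \<rho> assms(3), of z \<beta>] worst_case_top[OF \<rho> assms(3), of z \<beta>]
    by (auto intro: antisym)
  show "lp_norm p z + \<rho> / discrepancy TYPE('m) q p * lp_norm (conj_exponent q) \<beta>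
      \<le> worst_case \<rho> p q z \<beta>" for z :: "real ^ 'm" and \<beta> :: "real ^ 'n"
    by (rule worst_case_lower_bound[OF \<rho> assms(2,3)])
next
  fix \<beta> :: "real ^ 'n"
  assume *: "1 < p \<and> p < \<infinity> \<and> p \<noteq> q \<and> CARD('m) \<ge> 2" and \<beta>: "\<beta> \<noteq> 0"
  then have p: "1 < p" "p < top" "p \<noteq> q" "CARD('m) \<ge> 2" by auto
  show "\<exists>\<V> :: (real ^ 'm) set set. finite \<V> \<and> (\<forall>V\<in>\<V>. subspace V \<and> dim V = 1) \<and>
      {z :: real ^ 'm. worst_case \<rho> p q z \<beta>
         = lp_norm p z + \<rho> * discrepancy TYPE('m) p q * lp_norm (conj_exponent q) \<beta>}
      = \<Union>\<V>"
    by (rule worst_case_tight_set[OF assms(1) p(1,2) assms(3) p(3) \<beta>])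
  show "AE z :: real ^ 'm in lebesgue. worst_case \<rho> p q z \<beta>
      < lp_norm p z + \<rho> * discrepancy TYPE('m) p q * lp_norm (conj_exponent q) \<beta>"
    by (rule worst_case_AE_strict[OF assms(1) p(1,2) assms(3) p(3) \<beta> p(4)])
next
  fix \<beta> :: "real ^ 'n"
  assume "1 < p \<and> p < \<infinity>"
  then show "(INF z :: real ^ 'm. worst_case \<rho> p q z \<beta> - lp_norm p z
      - \<rho> / discrepancy TYPE('m) q p * lp_norm (conj_exponent q) \<beta>) = 0"
    using assms(1,3) by (intro worst_case_gap_INF) auto
qed

end
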